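(* Let $\Gamma<\mathrm{PSL}(2,\mathbb{R})$ be a torsion-free discrete subgroup, let $S=\Gamma\backslash\mathbb{H}^2$ be the associated hyperbolic surface, and let $u\in T^1S$. Suppose that the geodesic ray $u(\mathbb{R}^+)\subset S$ meets an infinite sequence of closed geodesics of $S$ whose lengths tend to zero. Then: (1) $h_{\mathbb{R}}u\subsetneq W^{ss}u$; (2) the set $W^{ss}u$ is an uncountable union of horocyclic orbits $h_{\mathbb{R}}v_i$, i.e. it is the union of an uncountable family of pairwise distinct orbits of the horocyclic flow.
   Context: $\mathbb{H}^2$ is the hyperbolic upper half-plane with boundary at infinity $\partial\mathbb{H}^2=\mathbb{R}\cup\{\infty\}$, on which $\mathrm{PSL}(2,\mathbb{R})$ acts by orientation-preserving isometries; $T^1\mathbb{H}^2$ is its unit tangent bundle and $T^1S=\Gamma\backslash T^1\mathbb{H}^2$. For a unit vector $v$, $v(t)$ denotes the point at time $t$ of the unit-speed geodesic determined by $v$, and $u(\mathbb{R}^+)=\{u(t):t\ge 0\}$. The geodesic flow is denoted $(g_t)_{t\in\mathbb{R}}$. The horocyclic flow $(h_s)_{s\in\mathbb{R}}$ on $T^1\mathbb{H}^2$ is defined as follows: $h_s(\tilde v)$ is obtained by moving $\tilde v$ along the horocycle passing through its basepoint $\tilde v(0)$ and centered at its forward endpoint $\tilde v(+\infty)\in\partial\mathbb{H}^2$, with $s$ equal to signed hyperbolic arc-length (so $h_s(\tilde v)$ has the same forward endpoint as $\tilde v$). Both flows commute with $\Gamma$ and descend to $T^1S$. $h_{\mathbb{R}}u=\{h_su: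 s\in\mathbb{R}\}$. Let $d_{Sa}$ be the Sasaki distance on $T^1S$, i.e. the distance induced by the Sasaki metric of the hyperbolic metric of $S$. The strong stable set of $u$ is $$W^{ss}u=\{v\in T^1S : \lim_{t\to+\infty}d_{Sa}(g_tu,g_tv)=0\}.$$ *)

theory Defs
  imports "HOL-Analysis.Analysis" "HOL-Algebra.Coset"
begin

section \<open>The group PSL(2,R) and its discrete torsion-free subgroups\<close>

definition SL2R :: "(real^2^2) monoid" where
  "SL2R = \<lparr>carrier = {A. det A = 1}, mult = (**), one = mat 1\<rparr>"

definition PSL2R :: "(real^2^2) set monoid" where
  "PSL2R = SL2R Mod {mat 1, - mat 1}"

text \<open>The quotient topology induced by the matrix topology of SL(2,R).\<close>

definition PSL2R_topology :: "(real^2^2) set topology" where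
  "PSL2R_topology = topology (\<lambda>U. U \<subseteq> carrier PSL2R \<and>
     openin (top_of_set (carrier SL2R)) {A \<in> carrier SL2R. {mat 1, - mat 1} #>\<^bsub>SL2R\<^esub> A \<in> U})"

definition discrete_subgroup :: "(real^2^2) set set \<Rightarrow> bool" where
  "discrete_subgroup \<Gamma> \<longleftrightarrow>
     subgroup \<Gamma> PSL2R \<and> subtopology PSL2R_topology \<Gamma> = discrete_topology \<Gamma>"

definition torsion_free :: "(real^2^2) set set \<Rightarrow> bool" where
  "torsion_free \<Gamma> \<longleftrightarrow>
     (\<forall>X\<in>\<Gamma>. \<forall>n>0. X [^]\<^bsub>PSL2R\<^esub> (n::nat) = \<one>\<^bsub>PSL2R\<^esub> \<longrightarrow> X = \<one>\<^bsub>PSL2R\<^esub>)"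


section \<open>The unit tangent bundle of the hyperbolic plane\<close>

definition H2 :: "complex set" where
  "H2 = {z. Im z > 0}"

text \<open>
  A tangent vector is a pair of a base point and a complex number; the hyperbolic metric is
  \<open>\<bar>dz\<bar>\<^sup>2 / (Im z)\<^sup>2\<close>.
\<close>

definition hyp_norm :: "complex \<times> complex \<Rightarrow> real" where
  "hyp_norm v = cmod (snd v) / Im (fst v)"

definition T1H2 :: "(complex \<times> complex) set" where
  "T1H2 = {v. fst v \<in> H2 \<and> hyp_norm v = 1}"

text \<open>
  The differential of the isometry \<open>z \<mapsto> (az + b) / (cz + d)\<close>, whose derivative is
  \<open>1 / (cz + d)\<^sup>2\<close>.
\<close>

definition SL2R_act :: "real^2^2 \<Rightarrow> complex \<times> complex \<Rightarrow> complex \<times> complex" where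
  "SL2R_act A v =
     ((of_real (A$1$1) * fst v + of_real (A$1$2)) / (of_real (A$2$1) * fst v + of_real (A$2$2)),
      snd v / (of_real (A$2$1) * fst v + of_real (A$2$2))\<^sup>2)"

text \<open>An element of PSL(2,R) is a coset \<open>{A, -A}\<close>, and both representatives act alike.\<close>

definition PSL2R_act :: "(real^2^2) set \<Rightarrow> complex \<times> complex \<Rightarrow> complex \<times> complex" where
  "PSL2R_act X v = the_elem ((\<lambda>A. SL2R_act A v) ` X)"


section \<open>Geodesic and horocyclic flow of the hyperbolic plane\<close>

text \<open>
  The Levi-Civita covariant derivative, along a curve \<open>z\<close> with velocity \<open>z'\<close>, of a vector field
  \<open>w\<close> with ordinary derivative \<open>w'\<close>. In the complex coordinate the only Christoffel symbol of the
  metric that enters is \<open>\<i> / Im z\<close>.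
\<close>

definition cov_deriv :: "complex \<Rightarrow> complex \<Rightarrow> complex \<Rightarrow> complex \<Rightarrow> complex" where
  "cov_deriv z z' w w' = w' + \<i> * z' * w / of_real (Im z)"

text \<open>A geodesic, recorded together with its velocity: the velocity is parallel along the curve.\<close>

definition geodesic_through :: "complex \<times> complex \<Rightarrow> (real \<Rightarrow> complex \<times> complex) \<Rightarrow> bool" where
  "geodesic_through v c \<longleftrightarrow> c 0 = v \<and>
     (\<forall>t. c t \<in> T1H2 \<and> ((\<lambda>t. fst (c t)) has_vector_derivative snd (c t)) (at t) \<and>
       (\<exists>w'. ((\<lambda>t. snd (c t)) has_vector_derivative w') (at t) \<and>
             cov_deriv (fst (c t)) (snd (c t)) (snd (c t)) w' = 0))"

definition geodesic_flow :: "real \<Rightarrow> complex \<times> complex \<Rightarrow> complex \<times> complex" where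
  "geodesic_flow t v = (THE c. geodesic_through v c) t"

datatype boundary = Fin real | Infty

definition forward_endpoint :: "complex \<times> complex \<Rightarrow> boundary \<Rightarrow> bool" where
  "forward_endpoint v \<xi> \<longleftrightarrow> (case \<xi> of
       Fin x \<Rightarrow> ((\<lambda>t. fst (geodesic_flow t v)) \<longlongrightarrow> of_real x) at_top
     | Infty \<Rightarrow> filterlim (\<lambda>t. fst (geodesic_flow t v)) at_infinity at_top)"

text \<open>
  Horocycles centered at a real point \<open>x\<close> are the Euclidean circles tangent to the real line at
  \<open>x\<close>, with \<open>x\<close> removed; those centered at infinity are the horizontal lines.
\<close>

definition horocycle_at :: "boundary \<Rightarrow> complex set \<Rightarrow> bool" where
  "horocycle_at \<xi> C \<longleftrightarrow> (\<exists>r>0. C = (case \<xi> of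
       Fin x \<Rightarrow> {z \<in> H2. cmod (z - Complex x r) = r}
     | Infty \<Rightarrow> {z. Im z = r}))"

text \<open>
  The last condition says that the base point moves orthogonally to the vector, to its right, and,
  the vector having norm 1, with hyperbolic speed 1; so the parameter is the signed arc length.
\<close>

definition horocyclic_motion :: "complex \<times> complex \<Rightarrow> (real \<Rightarrow> complex \<times> complex) \<Rightarrow> bool" where
  "horocyclic_motion v c \<longleftrightarrow> c 0 = v \<and>
     (\<exists>\<xi> C. forward_endpoint v \<xi> \<and> horocycle_at \<xi> C \<and>
       (\<forall>s. c s \<in> T1H2 \<and> fst (c s) \<in> C \<and> forward_endpoint (c s) \<xi> \<and>
            ((\<lambda>s. fst (c s)) has_vector_derivative - \<i> * snd (c s)) (at s)))"

definition horocyclic_flow :: "real \<Rightarrow> complex \<times> complex \<Rightarrow> complex \<times> complex" where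
  "horocyclic_flow s v = (THE c. horocyclic_motion v c) s"


section \<open>The unit tangent bundle of the surface\<close>

text \<open>
  Points of the quotient surface and of its unit tangent bundle are orbits of \<open>\<Gamma>\<close>. The flows
  descend to orbits by taking images, and the base point of an orbit of vectors is the orbit of
  their base points.
\<close>

definition T1S :: "(real^2^2) set set \<Rightarrow> (complex \<times> complex) set set" where
  "T1S \<Gamma> = (\<lambda>v. (\<lambda>X. PSL2R_act X v) ` \<Gamma>) ` T1H2"

definition geo :: "real \<Rightarrow> (complex \<times> complex) set \<Rightarrow> (complex \<times> complex) set" where
  "geo t u = geodesic_flow t ` u"

definition horo :: "real \<Rightarrow> (complex \<times> complex) set \<Rightarrow> (complex \<times> complex) set" where
  "horo s u = horocyclic_flow s ` u"

definition base_point :: "(complex \<times> complex) set \<Rightarrow> complex set" where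
  "base_point u = fst ` u"

definition horocyclic_orbit :: "(complex \<times> complex) set \<Rightarrow> (complex \<times> complex) set set" where
  "horocyclic_orbit u = range (\<lambda>s. horo s u)"

definition geodesic_ray :: "(complex \<times> complex) set \<Rightarrow> complex set set" where
  "geodesic_ray u = (\<lambda>t. base_point (geo t u)) ` {0..}"

definition closed_geodesic :: "(real^2^2) set set \<Rightarrow> complex set set \<Rightarrow> real \<Rightarrow> bool" where
  "closed_geodesic \<Gamma> C l \<longleftrightarrow> l > 0 \<and>
     (\<exists>v\<in>T1S \<Gamma>. geo l v = v \<and> C = range (\<lambda>t. base_point (geo t v)))"


section \<open>Sasaki distance and strong stable sets\<close>

definition sasaki_speed :: "(real \<Rightarrow> complex \<times> complex) \<Rightarrow> real \<Rightarrow> real" where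
  "sasaki_speed c t =
     (let z = fst (c t); w = snd (c t);
          z' = vector_derivative (\<lambda>t. fst (c t)) (at t);
          w' = vector_derivative (\<lambda>t. snd (c t)) (at t)
      in sqrt ((hyp_norm (z, z'))\<^sup>2 + (hyp_norm (z, cov_deriv z z' w w'))\<^sup>2))"

text \<open>
  Paths in the quotient are the projections of paths upstairs, so the distance of two orbits is
  the infimum of the lengths of the paths from one orbit to the other. In the library a piecewise
  \<open>C\<^sup>1\<close> path may have unbounded derivative near a break point; as \<^const>\<open>integral\<close> is 0 on
  nonintegrable functions, finite length has to be required.
\<close>

definition sasaki_dist :: "(complex \<times> complex) set \<Rightarrow> (complex \<times> complex) set \<Rightarrow> real" where
  "sasaki_dist u v = Inf {integral {0..1} (sasaki_speed c) | c.
     valid_path c \<and> path_image c \<subseteq> T1H2 \<and> sasaki_speed c integrable_on {0..1} \<and>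
     pathstart c \<in> u \<and> pathfinish c \<in> v}"

definition strong_stable_set ::
    "(real^2^2) set set \<Rightarrow> (complex \<times> complex) set \<Rightarrow> (complex \<times> complex) set set" where
  "strong_stable_set \<Gamma> u =
     {v \<in> T1S \<Gamma>. ((\<lambda>t. sasaki_dist (geo t u) (geo t v)) \<longlongrightarrow> 0) at_top}"


section \<open>The group structure, the topology and the flows are well defined\<close>

definition M2 :: "real \<Rightarrow> real \<Rightarrow> real \<Rightarrow> real \<Rightarrow> real^2^2" where
  "M2 a b c d = vector [vector [a, b], vector [c, d]]"

lemma M2_nth [simp]:
  "M2 a b c d $1$1 = a" "M2 a b c d $1$2 = b" "M2 a b c d $2$1 = c" "M2 a b c d $2$2 = d"
  by (simp_all add: M2_def)

lemma SL2R_simps [simp]: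
  "A \<in> carrier SL2R \<longleftrightarrow> det A = 1" "A \<otimes>\<^bsub>SL2R\<^esub> B = A ** B" "\<one>\<^bsub>SL2R\<^esub> = mat 1"
  by (simp_all add: SL2R_def)

lemma group_SL2R: "group SL2R"
proof (rule groupI)
  fix A assume A: "A \<in> carrier SL2R"
  let ?B = "M2 (A$2$2) (- A$1$2) (- A$2$1) (A$1$1)"
  have "?B \<in> carrier SL2R" "?B \<otimes>\<^bsub>SL2R\<^esub> A = \<one>\<^bsub>SL2R\<^esub>"
    using A by (auto simp: det_2 vec_eq_iff forall_2 matrix_matrix_mult_def sum_2 mat_def algebra_simps)
  then show "\<exists>B\<in>carrier SL2R. B \<otimes>\<^bsub>SL2R\<^esub> A = \<one>\<^bsub>SL2R\<^esub>" by blast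
qed (auto simp: det_mul matrix_mul_assoc)

lemma mult_uminus:
  fixes A B :: "real^2^2" shows "(- A) ** B = - (A ** B)" "A ** (- B) = - (A ** B)"
  by (simp_all add: vec_eq_iff forall_2 matrix_matrix_mult_def sum_2)

lemma normal_center_SL2R: "{mat 1, - mat 1} \<lhd> SL2R"
proof -
  interpret group SL2R by (rule group_SL2R)
  have "subgroup {mat 1, - mat 1} SL2R"
  proof (rule subgroupI)
    fix a assume "a \<in> {mat 1, - mat 1 :: real^2^2}"
    moreover have "inv\<^bsub>SL2R\<^esub> (- mat 1) = - mat 1"
      by (rule inv_equality) (simp_all add: mult_uminus, simp_all add: det_2, simp_all add: mat_def)
    ultimately show "inv\<^bsub>SL2R\<^esub> a \<in> {mat 1, - mat 1}"
      using inv_one by auto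
  qed (auto simp: mult_uminus, auto simp: det_2 mat_def)
  then show ?thesis
    by (auto simp: normal_def normal_axioms_def group_SL2R r_coset_def l_coset_def mult_uminus)
qed

lemma group_PSL2R: "group PSL2R"
  unfolding PSL2R_def by (rule normal.factorgroup_is_group[OF normal_center_SL2R])

lemma PSL2R_coset: "{mat 1, - mat 1} #>\<^bsub>SL2R\<^esub> A = {A, - A}"
  by (auto simp: r_coset_def mult_uminus)

lemma openin_PSL2R_topology:
  "openin PSL2R_topology U \<longleftrightarrow> U \<subseteq> carrier PSL2R \<and>
     openin (top_of_set (carrier SL2R)) {A \<in> carrier SL2R. {mat 1, - mat 1} #>\<^bsub>SL2R\<^esub> A \<in> U}"
proof -
  let ?c = "\<lambda>A. {mat 1, - mat 1} #>\<^bsub>SL2R\<^esub> A"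
  have "istopology (\<lambda>U. U \<subseteq> carrier PSL2R \<and>
     openin (top_of_set (carrier SL2R)) {A \<in> carrier SL2R. ?c A \<in> U})"
    unfolding istopology_def
  proof (intro conjI allI impI; (elim conjE)?)
    fix S T assume "openin (top_of_set (carrier SL2R)) {A \<in> carrier SL2R. ?c A \<in> S}"
      "openin (top_of_set (carrier SL2R)) {A \<in> carrier SL2R. ?c A \<in> T}"
    from openin_Int[OF this]
    show "openin (top_of_set (carrier SL2R)) {A \<in> carrier SL2R. ?c A \<in> S \<inter> T}"
      by (rule back_subst) auto
  next
    fix K assume K: "\<forall>U\<in>K. U \<subseteq> carrier PSL2R \<and>
      openin (top_of_set (carrier SL2R)) {A \<in> carrier SL2R. ?c A \<in> U}"
    have "openin (top_of_set (carrier SL2R)) (\<Union>U\<in>K. {A \<in> carrier SL2R. ?c A \<in> U})"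
      using K by (intro openin_Union) auto
    then show "openin (top_of_set (carrier SL2R)) {A \<in> carrier SL2R. ?c A \<in> \<Union>K}"
      by (rule back_subst) auto
  qed auto
  then show ?thesis unfolding PSL2R_topology_def by (simp add: topology_inverse')
qed

lemma carrier_PSL2R: "carrier PSL2R = {{A, - A} | A. det A = 1}"
  by (auto simp: PSL2R_def FactGroup_def RCOSETS_def PSL2R_coset)

lemma SL2R_act_uminus: "SL2R_act (- A) v = SL2R_act A v"
proof -
  let ?n = "of_real (A$1$1) * fst v + of_real (A$1$2)"
  let ?d = "of_real (A$2$1) * fst v + of_real (A$2$2)"
  have 1: "of_real ((-A)$1$1) * fst v + of_real ((-A)$1$2) = - ?n"
    and 2: "of_real ((-A)$2$1) * fst v + of_real ((-A)$2$2) = - ?d" by simp_all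
  show ?thesis unfolding SL2R_act_def 1 2 by (simp only: minus_divide_divide power2_minus)
qed

lemma PSL2R_act_coset: "PSL2R_act {A, - A} v = SL2R_act A v"
  by (simp add: PSL2R_act_def SL2R_act_uminus)

lemma T1H2_iff: "v \<in> T1H2 \<longleftrightarrow> Im (fst v) > 0 \<and> cmod (snd v) = Im (fst v)"
  by (auto simp: T1H2_def H2_def hyp_norm_def)

lemma denom_nz:
  fixes A :: "real^2^2"
  assumes "det A = 1" "Im z > 0"
  shows "of_real (A$2$1) * z + of_real (A$2$2) \<noteq> (0::complex)"
  using assms by (auto simp: complex_eq_iff det_2)

lemma Im_SL2R_act:
  assumes "det A = 1" "Im (fst v) > 0"
  shows "Im (fst (SL2R_act A v)) = Im (fst v) / (cmod (of_real (A$2$1) * fst v + of_real (A$2$2)))\<^sup>2"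
proof -
  have "Im (fst (SL2R_act A v)) = det A * Im (fst v) / (cmod (of_real (A$2$1) * fst v + of_real (A$2$2)))\<^sup>2"
    unfolding SL2R_act_def by (simp add: Im_divide cmod_power2 det_2 algebra_simps)
  then show ?thesis using assms by simp
qed

lemma SL2R_act_T1H2: "det A = 1 \<Longrightarrow> v \<in> T1H2 \<Longrightarrow> SL2R_act A v \<in> T1H2"
  using denom_nz[of A "fst v"]
  by (auto simp: T1H2_iff Im_SL2R_act) (simp add: SL2R_act_def norm_divide norm_power)

lemma SL2R_act_mult:
  assumes "det A = 1" "det B = 1" "Im (fst v) > 0"
  shows "SL2R_act A (SL2R_act B v) = SL2R_act (A ** B) v"
proof -
  let ?n = "of_real (B$1$1) * fst v + of_real (B$1$2)"
  let ?d = "of_real (B$2$1) * fst v + of_real (B$2$2)"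
  have d: "?d \<noteq> 0" using denom_nz assms by blast
  have 1: "of_real ((A**B)$i$1) * fst v + of_real ((A**B)$i$2)
        = of_real (A$i$1) * ?n + of_real (A$i$2) * ?d" for i
    by (simp add: matrix_matrix_mult_def sum_2 algebra_simps)
  have 2: "of_real (A$i$1) * (?n/?d) + of_real (A$i$2) = (of_real (A$i$1) * ?n + of_real (A$i$2) * ?d)/?d" for i
    proof -
    have "p * (n / D) + q = (p * n + q * D) / D" if "D \<noteq> 0" for p n q D :: complex
      using that by (simp add: field_simps)
    then show ?thesis using d by blast
  qed
  show ?thesis unfolding SL2R_act_def fst_conv snd_conv 1 2 using d by (simp add: power_divide)
qed

lemma SL2R_act_one: "SL2R_act (mat 1) v = v"
  by (simp add: SL2R_act_def mat_def)

lemma SL2R_transitive: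
  assumes "v \<in> T1H2" obtains A where "det A = 1" "v = SL2R_act A (\<i>, \<i>)"
proof -
  obtain z w where v: "v = (z, w)" by force
  have z: "Im z > 0" "cmod w = Im z" using assms by (auto simp: v T1H2_iff)
  define q where "q = csqrt (\<i> / w)"
  have w0: "w \<noteq> 0" using z by auto
  have q2: "q\<^sup>2 = \<i> / w" by (simp add: q_def)
  have "(cmod q)\<^sup>2 = 1 / Im z" using q2 z by (metis norm_divide norm_ii norm_power)
  then have n: "(Re q)\<^sup>2 + (Im q)\<^sup>2 = 1 / Im z" by (simp add: cmod_power2)
  have q0: "q \<noteq> 0" using q2 w0 by auto
  define A where "A = M2 (Im (z*q)) (Re (z*q)) (Im q) (Re q)"
  have "det A = Im z * ((Re q)\<^sup>2 + (Im q)\<^sup>2)"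
    by (simp add: A_def det_2 power2_eq_square algebra_simps)
  then have 1: "det A = 1" using n z by simp
  have 2: "of_real (A$2$1) * \<i> + of_real (A$2$2) = q" "of_real (A$1$1) * \<i> + of_real (A$1$2) = z * q"
    by (auto simp: A_def complex_eq_iff)
  have "SL2R_act A (\<i>, \<i>) = v"
    unfolding SL2R_act_def fst_conv snd_conv 2 using q0 w0 by (simp add: v q2)
  with 1 that show ?thesis by blast
qed

lemma det_of_real:
  fixes A :: "real^2^2"
  assumes "det A = 1"
  shows "of_real (A$1$1) * of_real (A$2$2) - of_real (A$1$2) * of_real (A$2$1) = (1::complex)"
proof -
  have "of_real (A$1$1 * A$2$2 - A$1$2 * A$2$1) = (1::complex)"
    using assms by (simp only: det_2 of_real_1)
  then show ?thesis by simp
qed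

lemma act_fst_deriv:
  assumes "det A = 1" "Im (fst (c t)) > 0" "((\<lambda>t. fst (c t)) has_vector_derivative z') (at t)"
  shows "((\<lambda>t. fst (SL2R_act A (c t))) has_vector_derivative
     z' / (of_real (A$2$1) * fst (c t) + of_real (A$2$2))\<^sup>2) (at t)"
proof -
  let ?d = "of_real (A$2$1) * fst (c t) + of_real (A$2$2)"
  have d: "?d \<noteq> 0" using denom_nz assms by blast
  have det: "of_real (A$1$1) * of_real (A$2$2) - of_real (A$1$2) * of_real (A$2$1) = (1::complex)"
    by (rule det_of_real[OF assms(1)])
  have "((\<lambda>z. (of_real (A$1$1) * z + of_real (A$1$2)) / (of_real (A$2$1) * z + of_real (A$2$2)))
     has_field_derivative 1 / ?d\<^sup>2) (at (fst (c t)))"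
    apply (rule derivative_eq_intros refl d)+
    using d det by (simp add: power2_eq_square algebra_simps)
  from field_vector_diff_chain_at[OF assms(3) this] show ?thesis
    by (simp add: SL2R_act_def o_def)
qed

lemma has_vector_derivative_divide_complex:
  fixes f g :: "real \<Rightarrow> complex"
  assumes "(f has_vector_derivative f') (at t)" "(g has_vector_derivative g') (at t)" "g t \<noteq> 0"
  shows "((\<lambda>t. f t / g t) has_vector_derivative (f' * g t - f t * g') / (g t * g t)) (at t)"
proof -
  have "((\<lambda>t. inverse (g t)) has_vector_derivative (g' * - (inverse (g t * g t)))) (at t)"
    using field_vector_diff_chain_at[OF assms(2) DERIV_inverse[OF assms(3)]]
    by (simp add: o_def power2_eq_square)
  from has_vector_derivative_mult[OF assms(1) this] show ?thesis
    using assms(3) by (simp add: field_simps)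
qed

lemma geodesic_through_act:
  assumes A: "det A = 1" and g: "geodesic_through v c"
  shows "geodesic_through (SL2R_act A v) (\<lambda>t. SL2R_act A (c t))"
proof -
  have c0: "c 0 = v" and T: "\<And>t. c t \<in> T1H2"
    and z': "\<And>t. ((\<lambda>t. fst (c t)) has_vector_derivative snd (c t)) (at t)"
    using g by (auto simp: geodesic_through_def)
  show ?thesis unfolding geodesic_through_def
  proof (intro conjI allI)
    fix t
    obtain w' where w': "((\<lambda>t. snd (c t)) has_vector_derivative w') (at t)"
       and cv: "cov_deriv (fst (c t)) (snd (c t)) (snd (c t)) w' = 0"
      using g by (auto simp: geodesic_through_def)
    let ?d = "\<lambda>t. of_real (A$2$1) * fst (c t) + of_real (A$2$2)"
    let ?a = "of_real (A$2$1) :: complex"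
    have I: "Im (fst (c t)) > 0" using T by (auto simp: T1H2_iff)
    have d: "?d t \<noteq> 0" using denom_nz A I by blast
    show "SL2R_act A (c t) \<in> T1H2" using SL2R_act_T1H2 A T by blast
    show "((\<lambda>t. fst (SL2R_act A (c t))) has_vector_derivative snd (SL2R_act A (c t))) (at t)"
      using act_fst_deriv[OF A I z'] by (simp add: SL2R_act_def)
    have d': "(?d has_vector_derivative ?a * snd (c t)) (at t)"
      using z'[of t] by (auto intro!: derivative_eq_intros)
    have d2: "((\<lambda>t. (?d t)\<^sup>2) has_vector_derivative 2 * ?d t * (?a * snd (c t))) (at t)"
      using has_vector_derivative_mult[OF d' d'] by (simp add: power2_eq_square algebra_simps)
    define W where "W = (w' * (?d t)\<^sup>2 - snd (c t) * (2 * ?d t * (?a * snd (c t)))) / ((?d t)\<^sup>2 * (?d t)\<^sup>2)"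
    have "((\<lambda>t. snd (SL2R_act A (c t))) has_vector_derivative W) (at t)"
      unfolding SL2R_act_def snd_conv W_def
      by (rule has_vector_derivative_divide_complex[OF w' d2]) (use d in simp)
    moreover have "cov_deriv (fst (SL2R_act A (c t))) (snd (SL2R_act A (c t))) (snd (SL2R_act A (c t))) W = 0"
    proof -
      let ?z = "fst (c t)" and ?w = "snd (c t)"
      let ?y = "of_real (Im (fst (c t))) :: complex"
      have y: "?y \<noteq> 0" using I by simp
      have w'e: "w' = - \<i> * ?w * ?w / ?y" using cv by (simp add: cov_deriv_def add_eq_0_iff)
      have n: "of_real ((cmod (?d t))\<^sup>2) = ?d t * cnj (?d t)"
        by (simp only: complex_norm_square)
      have cd: "cnj (?d t) = ?d t - 2 * \<i> * ?a * ?y"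
        by (auto simp: complex_eq_iff)
      have im: "of_real (Im (fst (SL2R_act A (c t)))) = ?y / (?d t * cnj (?d t))"
        unfolding Im_SL2R_act[OF A I] of_real_divide n ..
      have cd0: "cnj (?d t) \<noteq> 0" using d complex_cnj_zero_iff by metis
      have s: "snd (SL2R_act A (c t)) = ?w / (?d t)\<^sup>2" by (simp add: SL2R_act_def)
      have key: "(- \<i> * w * w / y * D\<^sup>2 - w * (2 * D * (a * w))) / (D\<^sup>2 * D\<^sup>2) + \<i> * w * w * (D - 2 * \<i> * a * y) / (y * D^3) = 0"
        if "D \<noteq> 0" "y \<noteq> 0" for w D a y :: complex
        using that by (simp add: field_simps power2_eq_square power3_eq_cube)
      have e1: "\<i> * (?w / (?d t)\<^sup>2) * (?w / (?d t)\<^sup>2) / (?y / (?d t * cnj (?d t))) =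
         \<i> * ?w * ?w * cnj (?d t) / (?y * ?d t ^ 3)"
        using d y by (simp add: divide_simps power2_eq_square power3_eq_cube)
      show ?thesis unfolding cov_deriv_def im s W_def w'e unfolding e1 unfolding cd
        by (rule key[OF d y])
    qed
    ultimately show "\<exists>w'. ((\<lambda>t. snd (SL2R_act A (c t))) has_vector_derivative w') (at t) \<and>
       cov_deriv (fst (SL2R_act A (c t))) (snd (SL2R_act A (c t))) (snd (SL2R_act A (c t))) w' = 0" by blast
  qed (simp add: c0)
qed

lemma geodesic_base:
  "geodesic_through (\<i>, \<i>) c \<longleftrightarrow> c = (\<lambda>t. (\<i> * of_real (exp t), \<i> * of_real (exp t)))"
proof
  assume g: "geodesic_through (\<i>, \<i>) c"
  have c0: "c 0 = (\<i>, \<i>)" and T: "\<And>t. Im (fst (c t)) > 0"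
    and z': "\<And>t. ((\<lambda>t. fst (c t)) has_vector_derivative snd (c t)) (at t)"
    using g by (auto simp: geodesic_through_def T1H2_iff)
  have w': "((\<lambda>t. snd (c t)) has_vector_derivative - (\<i> * snd (c t) * snd (c t) / of_real (Im (fst (c t))))) (at t)" for t
    using g by (auto simp: geodesic_through_def cov_deriv_def add_eq_0_iff2)
  define x y p q where d: "x = (\<lambda>t. Re (fst (c t)))" "y = (\<lambda>t. Im (fst (c t)))"
     "p = (\<lambda>t. Re (snd (c t)))" "q = (\<lambda>t. Im (snd (c t)))"
  have y: "y t \<noteq> 0" for t using T[of t] by (simp add: d)
  have R: "(f has_vector_derivative f') (at t) \<Longrightarrow> ((\<lambda>t. Re (f t)) has_real_derivative Re f') (at t)"
    and I: "(f has_vector_derivative f') (at t) \<Longrightarrow> ((\<lambda>t. Im (f t)) has_real_derivative Im f') (at t)" 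
      for f f' and t :: real
    unfolding has_real_derivative_iff_has_vector_derivative
    by (auto intro: bounded_linear.has_vector_derivative bounded_linear_Re bounded_linear_Im)
  have dx: "(x has_real_derivative p t) (at t)" and dy: "(y has_real_derivative q t) (at t)" for t
    using R[OF z'] I[OF z'] by (auto simp: d)
  have dp: "(p has_real_derivative 2 * p t * q t / y t) (at t)" for t
    using R[OF w'[of t]] by (simp add: d field_simps)
  have dq: "(q has_real_derivative (q t * q t - p t * p t) / y t) (at t)" for t
    using I[OF w'[of t]] by (simp add: d diff_divide_distrib)
  have const: "f t = f 0" if "\<And>t. (f has_real_derivative 0) (at t)" for f :: "real \<Rightarrow> real" and t
    using DERIV_isconst_all[of f] that by blast
  have "p t / (y t)\<^sup>2 = p 0 / (y 0)\<^sup>2" for t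
    apply (rule const)
    apply (rule derivative_eq_intros dp dy refl)+
    using y by (auto simp: field_simps power2_eq_square)
  moreover have "p 0 = 0" "x 0 = 0" "y 0 = 1" "q 0 = 1" by (auto simp: d c0)
  ultimately have p: "p t = 0" for t using y by simp
  have "x t = x 0" for t using dx by (intro const) (simp add: p)
  then have x: "x t = 0" for t using \<open>x 0 = 0\<close> by simp
  have "q t / y t = q 0 / y 0" for t
    apply (rule const)
    apply (rule derivative_eq_intros dq dy refl)+
    using y p by (auto simp: field_simps power2_eq_square)
  then have q: "q t = y t" for t using y \<open>y 0 = 1\<close> \<open>q 0 = 1\<close> by (simp add: field_simps)
  have "y t * exp (- t) = y 0 * exp (- 0)" for t
    apply (rule const)
    apply (rule derivative_eq_intros dy refl)+
    by (simp add: q)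
  then have "y t = exp t" for t using \<open>y 0 = 1\<close> by (simp add: exp_minus field_simps)
  then show "c = (\<lambda>t. (\<i> * of_real (exp t), \<i> * of_real (exp t)))"
    using x p q by (auto simp: fun_eq_iff prod_eq_iff complex_eq_iff d)
next
  have E: "((\<lambda>t. \<i> * of_real (exp t)) has_vector_derivative \<i> * of_real (exp t)) (at t)" for t
    by (intro has_vector_derivative_mult_right has_vector_derivative_of_real)
       (simp flip: has_real_derivative_iff_has_vector_derivative add: DERIV_exp)
  assume "c = (\<lambda>t. (\<i> * of_real (exp t), \<i> * of_real (exp t)))"
  then show "geodesic_through (\<i>, \<i>) c" 
    unfolding geodesic_through_def
    using E by (auto simp: T1H2_iff norm_mult cov_deriv_def intro!: exI[of _ "\<i> * of_real (exp _)"])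
qed

definition inv2 :: "real^2^2 \<Rightarrow> real^2^2" where "inv2 A = M2 (A$2$2) (- A$1$2) (- A$2$1) (A$1$1)"

lemma inv2: assumes "det A = 1" shows "det (inv2 A) = 1" "inv2 A ** A = mat 1" "A ** inv2 A = mat 1"
  using assms by (auto simp: inv2_def det_2 vec_eq_iff forall_2 matrix_matrix_mult_def sum_2 mat_def algebra_simps)

lemma act_inv2:
  assumes "det A = 1" "Im (fst v) > 0"
  shows "SL2R_act A (SL2R_act (inv2 A) v) = v" "SL2R_act (inv2 A) (SL2R_act A v) = v"
  using assms inv2[OF assms(1)] by (simp_all add: SL2R_act_mult SL2R_act_one)

lemma geodesic_through_unique:
  assumes A: "det A = 1"
  shows "geodesic_through (SL2R_act A (\<i>, \<i>)) c \<longleftrightarrow>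
     c = (\<lambda>t. SL2R_act A (\<i> * of_real (exp t), \<i> * of_real (exp t)))"
proof
  assume g: "geodesic_through (SL2R_act A (\<i>, \<i>)) c"
  then have T: "\<And>t. Im (fst (c t)) > 0" by (auto simp: geodesic_through_def T1H2_iff)
  from geodesic_through_act[OF inv2(1)[OF A] g]
  have "(\<lambda>t. SL2R_act (inv2 A) (c t)) = (\<lambda>t. (\<i> * of_real (exp t), \<i> * of_real (exp t)))"
    using A by (simp add: act_inv2 geodesic_base)
  then have "SL2R_act A (SL2R_act (inv2 A) (c t)) = SL2R_act A (\<i> * of_real (exp t), \<i> * of_real (exp t))" for t
    by metis
  then show "c = (\<lambda>t. SL2R_act A (\<i> * of_real (exp t), \<i> * of_real (exp t)))"
    using A T by (simp add: act_inv2 fun_eq_iff)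
next
  assume "c = (\<lambda>t. SL2R_act A (\<i> * of_real (exp t), \<i> * of_real (exp t)))"
  then show "geodesic_through (SL2R_act A (\<i>, \<i>)) c"
    using geodesic_through_act[OF A, of "(\<i>,\<i>)"] geodesic_base by blast
qed

lemma geodesic_flow_eq:
  assumes "det A = 1"
  shows "geodesic_flow t (SL2R_act A (\<i>, \<i>)) = SL2R_act A (\<i> * of_real (exp t), \<i> * of_real (exp t))"
  unfolding geodesic_flow_def geodesic_through_unique[OF assms] by simp

definition endpt :: "real^2^2 \<Rightarrow> boundary" where
  "endpt A = (if A$2$1 = 0 then Infty else Fin (A$1$1 / A$2$1))"

lemma forward_endpoint_eq:
  assumes A: "det A = 1"
  shows "forward_endpoint (SL2R_act A (\<i>, \<i>)) \<xi> \<longleftrightarrow> \<xi> = endpt A"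
proof -
  let ?a = "of_real (A$1$1) :: complex" and ?b = "of_real (A$1$2) :: complex"
  and ?c = "of_real (A$2$1) :: complex" and ?d = "of_real (A$2$2) :: complex"
  define f where "f = (\<lambda>t. (?a * (\<i> * of_real (exp t)) + ?b) / (?c * (\<i> * of_real (exp t)) + ?d))"
  have f: "(\<lambda>t. fst (geodesic_flow t (SL2R_act A (\<i>, \<i>)))) = f"
    by (simp add: geodesic_flow_eq[OF A] f_def) (simp add: SL2R_act_def)
  have inf: "filterlim (\<lambda>t. \<i> * of_real (exp t) :: complex) at_infinity at_top"
    by (simp add: filterlim_at_infinity_conv_norm_at_top norm_mult exp_at_top)
  have E: "forward_endpoint (SL2R_act A (\<i>, \<i>)) (endpt A)"
  proof (cases "A$2$1 = 0")
    case True
    then have ad: "A$1$1 * A$2$2 = 1" using A by (simp add: det_2)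
    have "filterlim f at_infinity at_top"
    proof -
      have "filterlim (\<lambda>t. ?b / ?d + (?a / ?d) * (\<i> * of_real (exp t))) at_infinity at_top"
        using ad by (intro tendsto_add_filterlim_at_infinity tendsto_mult_filterlim_at_infinity inf tendsto_const) auto
      then show ?thesis using ad by (simp add: f_def True add_divide_distrib add.commute)
    qed
    then show ?thesis by (simp add: forward_endpoint_def f endpt_def True)
  next
    case False
    have "((\<lambda>t. inverse (\<i> * of_real (exp t) :: complex)) \<longlongrightarrow> 0) at_top"
      using tendsto_compose_filtermap inf tendsto_inverse_0 filterlim_compose by blast
    then have "((\<lambda>t. (?a + ?b * inverse (\<i> * of_real (exp t))) / (?c + ?d * inverse (\<i> * of_real (exp t)))) \<longlongrightarrow> (?a + ?b * 0) / (?c + ?d * 0)) at_top"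
      using False by (intro tendsto_intros) auto
    moreover have "(?a + ?b * inverse (\<i> * of_real (exp t))) / (?c + ?d * inverse (\<i> * of_real (exp t))) = f t" for t
    proof -
      have "(\<i> * of_real (exp t) :: complex) \<noteq> 0" by simp
      moreover have "(p + q * inverse e) / (r + s * inverse e) = (p * e + q) / (r * e + s)" if "e \<noteq> 0" for p q r s e :: complex
      proof -
        have "p + q * inverse e = (p * e + q) / e" "r + s * inverse e = (r * e + s) / e" 
          using that by (auto simp: field_simps)
        then show ?thesis using that by simp
      qed
      ultimately show ?thesis unfolding f_def by blast
    qed
    ultimately show ?thesis using False by (simp add: forward_endpoint_def f endpt_def)
  qed
  have "\<xi> = \<eta>" if "forward_endpoint v \<xi>" "forward_endpoint v \<eta>" for \<xi> \<eta> v
    using that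
    by (cases \<xi>; cases \<eta>)
       (auto simp: forward_endpoint_def dest: tendsto_unique[rotated] not_tendsto_and_filterlim_at_infinity[rotated])
  with E show ?thesis by blast
qed

lemma endpt_eq:
  assumes "det A = 1" "det B = 1"
  shows "endpt A = endpt B \<longleftrightarrow> (inv2 A ** B)$2$1 = 0"
proof -
  have e: "(inv2 A ** B)$2$1 = A$1$1 * B$2$1 - A$2$1 * B$1$1"
    by (simp add: inv2_def matrix_matrix_mult_def sum_2)
  have "A$2$1 = 0 \<Longrightarrow> A$1$1 \<noteq> 0" "B$2$1 = 0 \<Longrightarrow> B$1$1 \<noteq> 0"
    using assms by (auto simp: det_2)
  then show ?thesis unfolding e
    by (cases "A$2$1 = 0"; cases "B$2$1 = 0") (auto simp: endpt_def frac_eq_eq mult.commute)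
qed

lemma horocyclic_motion_unique:
  assumes A: "det A = 1"
  shows "horocyclic_motion (SL2R_act A (\<i>, \<i>)) c \<longleftrightarrow> c = (\<lambda>s. SL2R_act A (\<i> + of_real s, \<i>))"
proof
  assume h: "horocyclic_motion (SL2R_act A (\<i>, \<i>)) c"
  then have c0: "c 0 = SL2R_act A (\<i>, \<i>)" and T: "\<And>s. c s \<in> T1H2"
    and e: "\<And>s. forward_endpoint (c s) (endpt A)"
    and z': "\<And>s. ((\<lambda>s. fst (c s)) has_vector_derivative - \<i> * snd (c s)) (at s)"
    by (auto simp: horocyclic_motion_def forward_endpoint_eq[OF A])
  have I: "Im (fst (c s)) > 0" for s using T by (auto simp: T1H2_iff)
  define e where "e = (\<lambda>s. SL2R_act (inv2 A) (c s))"
  have e0: "e 0 = (\<i>, \<i>)" using A by (simp add: e_def c0 act_inv2)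
  have w: "snd (e s) = \<i> * of_real (Im (fst (e s)))" for s
  proof -
    obtain B where B: "det B = 1" "c s = SL2R_act B (\<i>, \<i>)" using SL2R_transitive T by blast
    define M where "M = inv2 A ** B"
    have M0: "M$2$1 = 0" using e[of s] B endpt_eq[OF A B(1)] by (simp add: forward_endpoint_eq M_def)
    have eM: "e s = SL2R_act M (\<i>, \<i>)" using A B inv2[OF A] by (simp add: e_def M_def SL2R_act_mult)
    have "det M = 1" using B inv2[OF A] by (simp add: M_def det_mul)
    then have "M$1$1 * M$2$2 = 1" using M0 by (simp add: det_2)
    then have m: "M$2$2 \<noteq> 0" "M$1$1 = 1 / M$2$2" by (auto simp: eq_divide_eq)
    show ?thesis unfolding eM by (simp add: SL2R_act_def M0 m complex_eq_iff Im_divide Re_divide power2_eq_square)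
  qed
  have de: "((\<lambda>s. fst (e s)) has_vector_derivative - \<i> * snd (e s)) (at s)" for s
    using act_fst_deriv[OF inv2(1)[OF A] I z', of s] by (simp add: e_def SL2R_act_def)
  then have de: "((\<lambda>s. fst (e s)) has_vector_derivative of_real (Im (fst (e s)))) (at s)" for s
    using de[of s] by (simp add: w flip: mult.assoc)
  have "((\<lambda>s. Im (fst (e s))) has_real_derivative 0) (at s)" for s
    unfolding has_real_derivative_iff_has_vector_derivative
    using bounded_linear.has_vector_derivative[OF bounded_linear_Im de[of s]] by simp
  then have Im1: "Im (fst (e s)) = 1" for s
    using DERIV_isconst_all[of "\<lambda>s. Im (fst (e s))" s 0] e0 by auto
  have "((\<lambda>s. Re (fst (e s)) - s) has_real_derivative 0) (at s)" for s
    using bounded_linear.has_vector_derivative[OF bounded_linear_Re de[of s]]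
    by (auto intro!: derivative_eq_intros simp: Im1 has_real_derivative_iff_has_vector_derivative)
  then have Re1: "Re (fst (e s)) = s" for s
    using DERIV_isconst_all[of "\<lambda>s. Re (fst (e s)) - s" s 0] e0 by auto
  have "e s = (\<i> + of_real s, \<i>)" for s
    using Re1[of s] Im1[of s] w[of s] by (auto simp: prod_eq_iff complex_eq_iff)
  then have "c s = SL2R_act A (\<i> + of_real s, \<i>)" for s
    using act_inv2(1)[OF A I, of s] by (simp add: e_def)
  then show "c = (\<lambda>s. SL2R_act A (\<i> + of_real s, \<i>))" by blast
next
  assume c: "c = (\<lambda>s. SL2R_act A (\<i> + of_real s, \<i>))"
  have T: "(\<i> + of_real s, \<i>) \<in> T1H2" for s by (simp add: T1H2_iff)
  have N: "det (M2 1 s 0 1) = 1" "(\<i> + of_real s, \<i>) = SL2R_act (M2 1 s 0 1) (\<i>, \<i>)" for s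
    by (auto simp: det_2 SL2R_act_def)
  have cs: "c s = SL2R_act (A ** M2 1 s 0 1) (\<i>, \<i>)" for s
    unfolding c N(2) using A N(1) by (simp add: SL2R_act_mult)
  have en: "endpt (A ** M2 1 s 0 1) = endpt A" for s
    by (simp add: endpt_def matrix_matrix_mult_def sum_2)
  have fe: "forward_endpoint (c s) (endpt A)" for s
    unfolding cs using A N(1) en by (simp add: forward_endpoint_eq det_mul)
  have d: "((\<lambda>s. fst (c s)) has_vector_derivative - \<i> * snd (c s)) (at s)" for s
  proof -
    have "((\<lambda>s. fst (\<i> + of_real s, \<i>)) has_vector_derivative 1) (at s)"
      by (auto intro!: derivative_eq_intros)
    from act_fst_deriv[OF A _ this] show ?thesis by (simp add: c SL2R_act_def)
  qed
  have Ims: "Im (fst (c s)) = 1 / (cmod (of_real (A$2$1) * (\<i> + of_real s) + of_real (A$2$2)))\<^sup>2" for s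
    unfolding c by (subst Im_SL2R_act) (use A in auto)
  have "\<exists>C. horocycle_at (endpt A) C \<and> (\<forall>s. fst (c s) \<in> C)"
  proof (cases "A$2$1 = 0")
    case True
    then have "A$2$2 \<noteq> 0" using A by (auto simp: det_2)
    with True show ?thesis unfolding horocycle_at_def
      by (intro exI[of _ "{z. Im z = 1 / (A$2$2)\<^sup>2}"]) (auto simp: endpt_def Ims intro!: exI[of _ "1 / (A$2$2)\<^sup>2"])
  next
    case False
    let ?c = "A$2$1" let ?x = "A$1$1 / ?c" let ?r = "1 / (2 * ?c\<^sup>2)"
    have tangent: "(cmod (z - Complex x r))\<^sup>2 = r\<^sup>2"
      if "(cmod (z - of_real x))\<^sup>2 = 2 * r * Im z" for z x r
      using that by (simp only: cmod_power2) (simp add: power2_eq_square algebra_simps)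
    have "cmod (fst (c s) - Complex ?x ?r) = ?r" for s
    proof -
      let ?z = "\<i> + of_real s :: complex"
      let ?D = "of_real ?c * ?z + of_real (A$2$2)"
      have D: "?D \<noteq> 0" using denom_nz A by simp
      have det: "of_real (A$1$1) * of_real (A$2$2) - of_real (A$1$2) * of_real ?c = (1::complex)"
        by (rule det_of_real[OF A])
      have "fst (c s) - of_real ?x = - 1 / (of_real ?c * ?D)"
      proof -
        have "(a * z + b) / (k * z + d) - a / k = - 1 / (k * (k * z + d))" 
          if "k * z + d \<noteq> 0" "k \<noteq> 0" "a * d - b * k = 1" for a b k d z :: complex
          using that(1,2) by (simp add: divide_simps) (use that(3) in algebra)
        then show ?thesis using D False det by (simp add: c SL2R_act_def)
      qed
      then have "cmod (fst (c s) - of_real ?x) = 1 / (\<bar>?c\<bar> * cmod ?D)"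
        by (simp add: norm_divide norm_mult)
      then have "(cmod (fst (c s) - of_real ?x))\<^sup>2 = 2 * ?r * Im (fst (c s))"
        using False D by (simp add: Ims power_divide power_mult_distrib)
      then have "(cmod (fst (c s) - Complex ?x ?r))\<^sup>2 = ?r\<^sup>2"
        using tangent[of "fst (c s)" ?x ?r] by simp
      then show ?thesis using power2_eq_iff_nonneg[of "cmod (fst (c s) - Complex ?x ?r)" ?r] by simp
    qed
    moreover have "fst (c s) \<in> H2" for s
      using SL2R_act_T1H2[OF A T] by (simp add: c T1H2_def)
    ultimately show ?thesis using False unfolding horocycle_at_def
      by (intro exI[of _ "{z \<in> H2. cmod (z - Complex ?x ?r) = ?r}"]) (auto simp: endpt_def intro!: exI[of _ ?r])
  qed
  then obtain C where C: "horocycle_at (endpt A) C" "\<And>s. fst (c s) \<in> C" by blast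
  show "horocyclic_motion (SL2R_act A (\<i>, \<i>)) c"
    unfolding horocyclic_motion_def
  proof (intro conjI exI allI)
    show "forward_endpoint (SL2R_act A (\<i>, \<i>)) (endpt A)" using A by (simp add: forward_endpoint_eq)
    show "c s \<in> T1H2" for s using SL2R_act_T1H2[OF A T] by (simp add: c)
  qed (use C d fe in \<open>auto simp: c\<close>)
qed

lemma horocyclic_flow_eq:
  assumes "det A = 1"
  shows "horocyclic_flow s (SL2R_act A (\<i>, \<i>)) = SL2R_act A (\<i> + of_real s, \<i>)"
  unfolding horocyclic_flow_def horocyclic_motion_unique[OF assms] by simp

end

theory Submission
  imports Defs
begin

text \<open>
  Identify a unit vector with the element of \<open>SL(2,R)\<close>, unique up to sign, that takes \<open>(\<i>, \<i>)\<close> to it. The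
  geodesic and horocyclic flows become right multiplication by \<open>a_t = geo_mat t\<close> and by the unipotent
  matrices \<open>horo_mat s\<close>, and \<open>\<Gamma>\<close> acts from the left. Let \<open>u\<close> be the class of \<open>g\<close>, and
  let \<open>H\<close> be the conjugate of \<open>\<Gamma>\<close> by the inverse of \<open>g\<close>. Since the Sasaki metric is
  invariant on the left, the class of \<open>g w\<close> lies in the strong stable set of \<open>u\<close> as soon as there are
  \<open>A_t\<close> in \<open>H\<close>, depending on the time, such that conjugating the product of the inverse of \<open>A_t\<close> with
  \<open>w\<close> by \<open>a_t\<close> gives matrices that tend to 1 (\<open>strong_stable_member\<close>).

  Suppose that a closed geodesic of length \<open>l\<close> crosses the ray at time \<open>t\<close>. The deck transformation
  that translates along it provides an element \<open>h\<close> of \<open>H\<close> whose conjugate by \<open>a_t\<close> is a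
  translation by \<open>l\<close> along a geodesic through \<open>\<i>\<close> (\<open>short_geodesic_crossing\<close>). For short geodesics
  this is nearly 1, and discreteness forces \<open>t\<close> to be large (\<open>arbitrarily_short_crossings\<close>). Geometrically,
  the ray may take one extra turn around the short geodesic at almost no cost.

  Choose a very sparse sequence of such elements \<open>h k\<close> and decide for every \<open>k\<close> independently whether the turn
  is taken. The products of the selected elements do not converge, but their first columns do, and there is a matrix
  \<open>w\<close> whose first column is the limit and whose geodesic follows, between two successive crossing times, the
  translate of the ray by the corresponding partial product (\<open>limit_mat_asymptotic\<close>). Hence every choice gives a
  point of the strong stable set. Different choices give different first columns (\<open>first_col_inj\<close>), so
  there are uncountably many of them. The unipotent matrices fix the first column; so two choices give the
  same horocyclic orbit only if their first columns are related by an element of \<open>H\<close>. As \<open>\<Gamma>\<close>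
  is countable (\<open>discrete_countable\<close>), uncountably many horocyclic orbits remain.

  The strong stable set is invariant under the horocyclic flow (\<open>strong_stable_horo\<close>), so it is the union of these and further
  horocyclic orbits. It contains the orbit of \<open>u\<close>, and differs from it because that is a single orbit.
\<close>

section \<open>The Sasaki metric\<close>

definition sasaki_norm :: "complex \<times> complex \<Rightarrow> complex \<Rightarrow> complex \<Rightarrow> real" where
  "sasaki_norm v z' w' =
     sqrt ((hyp_norm (fst v, z'))\<^sup>2 + (hyp_norm (fst v, cov_deriv (fst v) z' (snd v) w'))\<^sup>2)"

lemma sasaki_speed_eq:
  assumes "((\<lambda>t. fst (c t)) has_vector_derivative z') (at t)"
      and "((\<lambda>t. snd (c t)) has_vector_derivative w') (at t)"
  shows "sasaki_speed c t = sasaki_norm (c t) z' w'"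
  using assms by (simp add: sasaki_speed_def sasaki_norm_def Let_def vector_derivative_at)

lemma sasaki_norm_scale: "sasaki_norm v (of_real r * z') (of_real r * w') = \<bar>r\<bar> * sasaki_norm v z' w'"
proof -
  have h: "hyp_norm (z, of_real r * x) = \<bar>r\<bar> * hyp_norm (z, x)" for z x
    by (simp add: hyp_norm_def norm_mult)
  have c: "cov_deriv (fst v) (of_real r * z') (snd v) (of_real r * w')
      = of_real r * cov_deriv (fst v) z' (snd v) w'"
    by (simp add: cov_deriv_def algebra_simps)
  have "sqrt ((\<bar>r\<bar> * x)\<^sup>2 + (\<bar>r\<bar> * y)\<^sup>2) = \<bar>r\<bar> * sqrt (x\<^sup>2 + y\<^sup>2)" for x y
    by (simp add: power_mult_distrib real_sqrt_mult flip: distrib_left)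
  then show ?thesis unfolding sasaki_norm_def c h .
qed

abbreviation act_denom :: "real^2^2 \<Rightarrow> complex \<Rightarrow> complex" where
  "act_denom A z \<equiv> of_real (A$2$1) * z + of_real (A$2$2)"

text \<open>The second component of the differential of the action on \<open>T1H2\<close>, at \<open>v\<close>, applied to
  \<open>(z', w')\<close>.\<close>

definition act_snd_velocity where
  "act_snd_velocity A v z' w' =
     (w' * (act_denom A (fst v))\<^sup>2 - snd v * (2 * act_denom A (fst v) * (of_real (A$2$1) * z')))
       / ((act_denom A (fst v))\<^sup>2 * (act_denom A (fst v))\<^sup>2)"

lemma act_snd_deriv:
  assumes "det A = 1" "Im (fst (c t)) > 0"
    and z': "((\<lambda>t. fst (c t)) has_vector_derivative z') (at t)"
    and w': "((\<lambda>t. snd (c t)) has_vector_derivative w') (at t)"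
  shows "((\<lambda>t. snd (SL2R_act A (c t))) has_vector_derivative act_snd_velocity A (c t) z' w') (at t)"
proof -
  let ?d = "\<lambda>t. act_denom A (fst (c t))"
  have d: "?d t \<noteq> 0" using denom_nz assms by blast
  have d': "(?d has_vector_derivative of_real (A$2$1) * z') (at t)"
    using z' by (auto intro!: derivative_eq_intros)
  have d2: "((\<lambda>t. (?d t)\<^sup>2) has_vector_derivative 2 * ?d t * (of_real (A$2$1) * z')) (at t)"
    using has_vector_derivative_mult[OF d' d'] by (simp add: power2_eq_square algebra_simps)
  show ?thesis
    unfolding SL2R_act_def snd_conv act_snd_velocity_def
    by (rule has_vector_derivative_divide_complex[OF w' d2]) (use d in simp)
qed

text \<open>The Levi-Civita connection is natural under isometries: the term coming from the derivative of
  \<open>1 / (cz + d)\<^sup>2\<close> cancels against the change of the Christoffel symbol \<open>\<i> / Im z\<close>, because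
  the conjugate of \<open>cz + d\<close> is \<open>cz + d - 2 \<i> c Im z\<close>.\<close>

lemma cov_deriv_act:
  assumes A: "det A = 1" and I: "Im (fst v) > 0"
  shows "cov_deriv (fst (SL2R_act A v)) (z' / (act_denom A (fst v))\<^sup>2) (snd (SL2R_act A v))
            (act_snd_velocity A v z' w')
         = cov_deriv (fst v) z' (snd v) w' / (act_denom A (fst v))\<^sup>2"
proof -
  let ?D = "act_denom A (fst v)" and ?a = "of_real (A$2$1) :: complex"
  let ?y = "of_real (Im (fst v)) :: complex"
  have d: "?D \<noteq> 0" using denom_nz A I by blast
  have y: "?y \<noteq> 0" using I by simp
  have cd: "cnj ?D = ?D - 2 * \<i> * ?a * ?y" by (auto simp: complex_eq_iff)
  have im: "of_real (Im (fst (SL2R_act A v))) = ?y / (?D * cnj ?D)"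
    unfolding Im_SL2R_act[OF A I] of_real_divide by (simp only: complex_norm_square)
  have cd0: "cnj ?D \<noteq> 0" using d complex_cnj_zero_iff by metis
  have e1: "\<i> * (z' / ?D\<^sup>2) * (snd v / ?D\<^sup>2) / (?y / (?D * cnj ?D)) = \<i> * z' * snd v * cnj ?D / (?y * ?D ^ 3)"
    using d y by (simp add: divide_simps power2_eq_square power3_eq_cube)
  have key: "(w' * D\<^sup>2 - w * (2 * D * (a * z'))) / (D\<^sup>2 * D\<^sup>2) + \<i> * z' * w * (D - 2 * \<i> * a * y) / (y * D^3)
      = (w' + \<i> * z' * w / y) / D\<^sup>2"
    if "D \<noteq> 0" "y \<noteq> 0" for w D a y :: complex
    using that by (simp add: field_simps power2_eq_square power3_eq_cube)
  have s: "snd (SL2R_act A v) = snd v / ?D\<^sup>2" by (simp add: SL2R_act_def)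
  show ?thesis unfolding cov_deriv_def im s act_snd_velocity_def unfolding e1 unfolding cd
    by (rule key[OF d y])
qed

lemma sasaki_norm_act:
  assumes A: "det A = 1" and I: "Im (fst v) > 0"
  shows "sasaki_norm (SL2R_act A v) (z' / (act_denom A (fst v))\<^sup>2) (act_snd_velocity A v z' w')
         = sasaki_norm v z' w'"
proof -
  have "act_denom A (fst v) \<noteq> 0" using denom_nz A I by blast
  then have "hyp_norm (fst (SL2R_act A v), x / (act_denom A (fst v))\<^sup>2) = hyp_norm (fst v, x)" for x
    using I by (simp add: hyp_norm_def Im_SL2R_act[OF A I] norm_divide norm_power)
  then show ?thesis unfolding sasaki_norm_def cov_deriv_act[OF A I] by simp
qed

text \<open>A path in \<open>T1H2\<close> from \<open>(\<i>, \<i>)\<close>: the base point runs along the Euclidean segment to \<open>z\<close>,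
  and the vector turns at constant rate by \<open>\<theta>\<close> from the vertical. It is far from shortest, but its length
  has an elementary bound that tends to 0 with \<open>z - \<i>\<close> and \<open>\<theta>\<close>, and every vector is reached.\<close>

definition frame_path :: "complex \<Rightarrow> real \<Rightarrow> real \<Rightarrow> complex \<times> complex" where
  "frame_path z \<theta> t =
     (\<i> + of_real t * (z - \<i>), \<i> * of_real (1 + t * (Im z - 1)) * exp (\<i> * of_real (\<theta> * t)))"

lemma frame_path_Im:
  assumes "Im z > 0" "t \<in> {0..1}"
  shows "min 1 (Im z) \<le> Im (fst (frame_path z \<theta> t))"
proof -
  have "Im (fst (frame_path z \<theta> t)) = (1 - t) * 1 + t * Im z"
    by (simp add: frame_path_def algebra_simps)
  moreover have "(1 - t) * min 1 (Im z) + t * min 1 (Im z) \<le> (1 - t) * 1 + t * Im z"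
    using assms by (intro add_mono mult_left_mono) auto
  moreover have "(1 - t) * min 1 (Im z) + t * min 1 (Im z) = min 1 (Im z)"
    by (simp add: algebra_simps)
  ultimately show ?thesis by linarith
qed

lemma frame_path_T1H2:
  assumes "Im z > 0" "t \<in> {0..1}"
  shows "frame_path z \<theta> t \<in> T1H2"
proof -
  have "Im (fst (frame_path z \<theta> t)) > 0" using frame_path_Im[OF assms, of \<theta>] assms by linarith
  moreover have "Im (fst (frame_path z \<theta> t)) = 1 + t * (Im z - 1)" by (simp add: frame_path_def)
  moreover have "cmod (snd (frame_path z \<theta> t)) = \<bar>1 + t * (Im z - 1)\<bar>"
    by (simp add: frame_path_def norm_mult del: of_real_add of_real_mult of_real_diff)
  ultimately show ?thesis by (simp add: T1H2_iff)
qed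

definition frame_path_velocity where
  "frame_path_velocity z \<theta> t = \<i> * of_real (Im z - 1) * exp (\<i> * of_real (\<theta> * t))
     + \<i> * of_real (1 + t * (Im z - 1)) * (\<i> * of_real \<theta> * exp (\<i> * of_real (\<theta> * t)))"

lemma frame_path_derivs:
  shows "((\<lambda>t. fst (frame_path z \<theta> t)) has_vector_derivative z - \<i>) (at t)"
    and "((\<lambda>t. snd (frame_path z \<theta> t)) has_vector_derivative frame_path_velocity z \<theta> t) (at t)"
proof -
  show "((\<lambda>t. fst (frame_path z \<theta> t)) has_vector_derivative z - \<i>) (at t)"
    unfolding frame_path_def fst_conv by (auto intro!: derivative_eq_intros)
  have r: "((\<lambda>t. of_real (1 + t * (Im z - 1)) :: complex) has_vector_derivative of_real (Im z - 1)) (at t)"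
    by (auto intro!: derivative_eq_intros has_vector_derivative_of_real
          simp flip: has_real_derivative_iff_has_vector_derivative)
  have "((\<lambda>t. \<i> * of_real (\<theta> * t) :: complex) has_vector_derivative \<i> * of_real \<theta>) (at t)"
    by (intro has_vector_derivative_mult_right has_vector_derivative_of_real)
       (auto intro!: derivative_eq_intros simp flip: has_real_derivative_iff_has_vector_derivative)
  from field_vector_diff_chain_at[OF this DERIV_exp]
  have e: "((\<lambda>t. exp (\<i> * of_real (\<theta> * t))) has_vector_derivative
      \<i> * of_real \<theta> * exp (\<i> * of_real (\<theta> * t))) (at t)" by (simp add: o_def)
  from has_vector_derivative_mult[OF has_vector_derivative_mult_right[OF r, of \<i>] e]
  show "((\<lambda>t. snd (frame_path z \<theta> t)) has_vector_derivative frame_path_velocity z \<theta> t) (at t)"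
    unfolding frame_path_def snd_conv frame_path_velocity_def by (simp add: algebra_simps)
qed

lemma sasaki_norm_frame_path:
  assumes z: "Im z > 0" and t: "t \<in> {0..1}"
  shows "sasaki_norm (frame_path z \<theta> t) (z - \<i>) (frame_path_velocity z \<theta> t)
           \<le> 3 * cmod (z - \<i>) / min 1 (Im z) + \<bar>\<theta>\<bar>"
proof -
  define y where "y = 1 + t * (Im z - 1)"
  define e where "e = exp (\<i> * of_real (\<theta> * t))"
  define d where "d = cmod (z - \<i>)"
  have Im: "Im (fst (frame_path z \<theta> t)) = y" by (simp add: frame_path_def y_def)
  have m: "min 1 (Im z) \<le> y" using frame_path_Im[OF z t, of \<theta>] Im by simp
  then have y: "y > 0" using z by linarith
  have ne: "cmod e = 1" by (simp add: e_def del: of_real_mult)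
  have w: "snd (frame_path z \<theta> t) = \<i> * of_real y * e" by (simp add: frame_path_def y_def e_def)
  have cov: "cov_deriv (fst (frame_path z \<theta> t)) (z - \<i>) (snd (frame_path z \<theta> t)) (frame_path_velocity z \<theta> t)
      = \<i> * of_real (Im z - 1) * e - of_real (y * \<theta>) * e - (z - \<i>) * e"
  proof -
    have ii: "\<i> * a * (\<i> * b * e) = - (a * b * e)" for a b :: complex
    proof -
      have "\<i> * a * (\<i> * b * e) = (\<i> * \<i>) * (a * b * e)" by (simp only: mult_ac)
      then show ?thesis by simp
    qed
    have "\<i> * Z * (\<i> * of_real y * e) / of_real y = - (Z * e)" for Z
      using y by (simp add: ii)
    moreover have "frame_path_velocity z \<theta> t = \<i> * of_real (Im z - 1) * e - of_real (y * \<theta>) * e"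
      unfolding frame_path_velocity_def y_def[symmetric] e_def[symmetric] ii by simp
    ultimately show ?thesis unfolding cov_deriv_def Im w by simp
  qed
  have "\<bar>Im z - 1\<bar> \<le> d" using abs_Im_le_cmod[of "z - \<i>"] by (simp add: d_def)
  then have n: "cmod (cov_deriv (fst (frame_path z \<theta> t)) (z - \<i>) (snd (frame_path z \<theta> t))
      (frame_path_velocity z \<theta> t)) \<le> d + y * \<bar>\<theta>\<bar> + d"
    unfolding cov using y ne
    by (intro order_trans[OF norm_triangle_ineq4] add_mono)
       (simp_all add: norm_mult d_def abs_mult del: of_real_mult of_real_diff)
  have "sasaki_norm (frame_path z \<theta> t) (z - \<i>) (frame_path_velocity z \<theta> t)
      \<le> d / y + (d + y * \<bar>\<theta>\<bar> + d) / y"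
    unfolding sasaki_norm_def
    by (rule order_trans[OF sqrt_sum_squares_le_sum_abs], rule add_mono)
       (use y n in \<open>simp_all add: hyp_norm_def Im d_def divide_right_mono\<close>)
  also have "\<dots> = 3 * d / y + \<bar>\<theta>\<bar>" using y by (simp add: field_simps)
  also have "\<dots> \<le> 3 * d / min 1 (Im z) + \<bar>\<theta>\<bar>"
    using m y z by (intro add_right_mono divide_left_mono) (auto simp: d_def)
  finally show ?thesis by (simp add: d_def)
qed

text \<open>The length bound for the path from \<open>(\<i>, \<i>)\<close> to \<open>v\<close>; the logarithm recovers the angle
  between \<open>v\<close> and the vertical.\<close>

definition displacement :: "complex \<times> complex \<Rightarrow> real" where
  "displacement v = 3 * cmod (fst v - \<i>) / min 1 (Im (fst v))
     + \<bar>Im (Ln (snd v / (\<i> * of_real (Im (fst v)))))\<bar>"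

definition sasaki_path :: "(real \<Rightarrow> complex \<times> complex) \<Rightarrow> bool" where
  "sasaki_path c \<longleftrightarrow> valid_path c \<and> path_image c \<subseteq> T1H2 \<and> sasaki_speed c integrable_on {0..1}"

lemma short_path:
  assumes A: "det A = 1" and v: "v \<in> T1H2"
  obtains c where "sasaki_path c" "pathstart c = SL2R_act A (\<i>, \<i>)" "pathfinish c = SL2R_act A v"
    "integral {0..1} (sasaki_speed c) \<le> displacement v"
proof -
  define z \<theta> where "z = fst v" and "\<theta> = Im (Ln (snd v / (\<i> * of_real (Im (fst v)))))"
  have z: "Im z > 0" and w: "cmod (snd v) = Im z" using v by (auto simp: z_def T1H2_iff)
  define p where "p = frame_path z \<theta>"
  define c where "c = (\<lambda>t. SL2R_act A (p t))"
  have p0: "p 0 = (\<i>, \<i>)" by (simp add: p_def frame_path_def)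
  have p1: "p 1 = v"
  proof -
    define q where "q = snd v / (\<i> * of_real (Im z))"
    have q: "cmod q = 1" using w z by (simp add: q_def norm_divide norm_mult)
    then have "q \<noteq> 0" by auto
    then have "q = exp (Ln q)" by simp
    moreover have "Re (Ln q) = 0" using q \<open>q \<noteq> 0\<close> by simp
    then have "Ln q = \<i> * of_real \<theta>" by (simp add: complex_eq_iff \<theta>_def q_def z_def)
    ultimately have "q = exp (\<i> * of_real \<theta>)" by simp
    then show ?thesis using z by (simp add: p_def frame_path_def prod_eq_iff q_def z_def field_simps)
  qed
  have T: "p t \<in> T1H2" if "t \<in> {0..1}" for t using frame_path_T1H2[OF z that] by (simp add: p_def)
  then have I: "Im (fst (p t)) > 0" if "t \<in> {0..1}" for t using that by (auto simp: T1H2_iff)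
  have D: "act_denom A (fst (p t)) \<noteq> 0" if "t \<in> {0..1}" for t using denom_nz A I that by blast
  define z' w' where "z' = (\<lambda>t. (z - \<i>) / (act_denom A (fst (p t)))\<^sup>2)"
    and "w' = (\<lambda>t. act_snd_velocity A (p t) (z - \<i>) (frame_path_velocity z \<theta> t))"
  have dz: "((\<lambda>t. fst (c t)) has_vector_derivative z' t) (at t)" if "t \<in> {0..1}" for t
    unfolding c_def z'_def by (rule act_fst_deriv[where c=p, OF A I[OF that]]) (simp add: p_def frame_path_derivs)
  have dw: "((\<lambda>t. snd (c t)) has_vector_derivative w' t) (at t)" if "t \<in> {0..1}" for t
    unfolding c_def w'_def by (rule act_snd_deriv[where c=p, OF A I[OF that]]) (simp_all add: p_def frame_path_derivs)
  have speed: "sasaki_speed c t = sasaki_norm (p t) (z - \<i>) (frame_path_velocity z \<theta> t)" if "t \<in> {0..1}" for t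
    unfolding sasaki_speed_eq[OF dz[OF that] dw[OF that]] 
    unfolding c_def z'_def w'_def by (rule sasaki_norm_act[OF A I[OF that]])
  have contp: "continuous_on {0..1} p" "continuous_on {0..1} (frame_path_velocity z \<theta>)"
    unfolding p_def frame_path_def frame_path_velocity_def by (intro continuous_intros)+
  have "continuous_on {0..1} (\<lambda>t. sasaki_norm (p t) (z - \<i>) (frame_path_velocity z \<theta> t))"
    unfolding sasaki_norm_def hyp_norm_def cov_deriv_def fst_conv snd_conv using I
    by (intro continuous_intros contp) (auto simp: less_imp_neq[symmetric])
  then have int: "(\<lambda>t. sasaki_norm (p t) (z - \<i>) (frame_path_velocity z \<theta> t)) integrable_on {0..1}"
    by (rule integrable_continuous_real)
  have sint: "sasaki_speed c integrable_on {0..1}"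
    by (rule integrable_eq[OF int]) (simp add: speed)
  have "continuous_on {0..1} (\<lambda>t. (z' t, w' t))"
    unfolding z'_def w'_def act_snd_velocity_def using D
    by (intro continuous_intros contp) auto
  moreover have "(c has_vector_derivative (z' t, w' t)) (at t)" if "t \<in> {0..1}" for t
    using has_vector_derivative_Pair[OF dz[OF that] dw[OF that]] by simp
  ultimately have "c C1_differentiable_on {0..1}"
    unfolding C1_differentiable_on_def by (intro exI[of _ "\<lambda>t. (z' t, w' t)"] conjI ballI)
  then have "valid_path c" unfolding valid_path_def by (rule C1_differentiable_imp_piecewise)
  moreover have "path_image c \<subseteq> T1H2" unfolding path_image_def c_def using T SL2R_act_T1H2[OF A] by blast
  ultimately have "sasaki_path c" using sint by (simp add: sasaki_path_def)
  moreover have "integral {0..1} (sasaki_speed c) \<le> displacement v"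
  proof -
    have "integral {0..1} (sasaki_speed c) \<le> integral {0..1} (\<lambda>t::real. displacement v)"
      using sasaki_norm_frame_path[OF z, of _ \<theta>]
      by (intro integral_le sint) (auto simp: speed p_def displacement_def z_def \<theta>_def)
    then show ?thesis by simp
  qed
  ultimately show ?thesis using that by (simp add: pathstart_def pathfinish_def c_def p0 p1)
qed

lemma displacement_tendsto:
  "((\<lambda>k. displacement (SL2R_act k (\<i>, \<i>))) \<longlongrightarrow> 0) (at (mat 1 :: real^2^2))"
proof -
  have c: "((\<lambda>k::real^2^2. k$i$j) \<longlongrightarrow> mat 1$i$j) (at (mat 1))" for i j by (intro tendsto_intros)
  have m: "mat 1$1$1 = (1::real)" "mat 1$(1::2)$2 = (0::real)" "mat 1$(2::2)$1 = (0::real)"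
     "mat 1$(2::2)$2 = (1::real)"
    by (simp_all add: mat_def)
  have e: "((\<lambda>k::real^2^2. (of_real (k$1$1) * \<i> + of_real (k$1$2)) / (of_real (k$2$1) * \<i> + of_real (k$2$2)))
     \<longlongrightarrow> (of_real 1 * \<i> + of_real 0) / (of_real 0 * \<i> + of_real 1)) (at (mat 1))" (is "(?z \<longlongrightarrow> _) _")
    using c[of 1 1] c[of 1 2] c[of 2 1] c[of 2 2] unfolding m by (intro tendsto_intros) auto
  have f: "((\<lambda>k::real^2^2. \<i> / (of_real (k$2$1) * \<i> + of_real (k$2$2))\<^sup>2)
     \<longlongrightarrow> \<i> / (of_real 0 * \<i> + of_real 1)\<^sup>2) (at (mat 1))" (is "(?w \<longlongrightarrow> _) _")
    using c[of 1 1] c[of 1 2] c[of 2 1] c[of 2 2] unfolding m by (intro tendsto_intros) auto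
  have e: "(?z \<longlongrightarrow> \<i>) (at (mat 1))" and f: "(?w \<longlongrightarrow> \<i>) (at (mat 1))" using e f by simp_all
  have "((\<lambda>k. 3 * cmod (?z k - \<i>) / min 1 (Im (?z k)) + \<bar>Im (Ln (?w k / (\<i> * of_real (Im (?z k)))))\<bar>) \<longlongrightarrow>
      3 * cmod (\<i> - \<i>) / min 1 (Im \<i>) + \<bar>Im (Ln (\<i> / (\<i> * of_real (Im \<i>))))\<bar>) (at (mat 1))"
    by (intro tendsto_intros e f) auto
  then show ?thesis by (simp add: displacement_def SL2R_act_def)
qed

lemma displacement_small:
  assumes "\<epsilon> > 0"
  obtains \<delta> where "\<delta> > 0" "\<And>k::real^2^2. dist k (mat 1) < \<delta> \<Longrightarrow> displacement (SL2R_act k (\<i>, \<i>)) < \<epsilon>"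
proof -
  from LIM_D[OF displacement_tendsto assms] obtain \<delta> where d: "\<delta> > 0"
    "\<And>k. k \<noteq> mat 1 \<and> norm (k - mat 1) < \<delta> \<longrightarrow> norm (displacement (SL2R_act k (\<i>, \<i>)) - 0) < \<epsilon>" by blast
  have "displacement (SL2R_act (mat 1) (\<i>, \<i>)) = 0" by (simp add: displacement_def SL2R_act_one)
  with d assms show ?thesis using that[of \<delta>] by (metis abs_less_iff diff_zero dist_norm real_norm_def)
qed

text \<open>The chain rule for an affine change of time, stated for a curve \<open>d\<close> that agrees with the
  rescaled \<open>c\<close> only near \<open>t\<close>, as each half of a joined path does.\<close>

lemma sasaki_speed_join:
  assumes c: "c differentiable at s" and s: "s = a * t + b" and a: "a > 0" and S: "open S" "t \<in> S"
    and d: "\<And>x. x \<in> S \<Longrightarrow> d x = c (a * x + b)"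
  shows "sasaki_speed d t = a * sasaki_speed c s"
proof -
  obtain D where D: "(c has_vector_derivative D) (at s)"
    using c vector_derivative_works by blast
  have cz: "((\<lambda>t. fst (c t)) has_vector_derivative fst D) (at s)"
    using bounded_linear.has_vector_derivative[OF bounded_linear_fst D] .
  have cw: "((\<lambda>t. snd (c t)) has_vector_derivative snd D) (at s)"
    using bounded_linear.has_vector_derivative[OF bounded_linear_snd D] .
  have l: "((\<lambda>x. a * x + b) has_vector_derivative a) (at t)"
    by (auto intro!: derivative_eq_intros simp flip: has_real_derivative_iff_has_vector_derivative)
  have t: "(f has_vector_derivative E) (at s) \<Longrightarrow> (\<And>x. x \<in> S \<Longrightarrow> g x = f (a * x + b)) \<Longrightarrow>
     (g has_vector_derivative of_real a * E) (at t)" for f g :: "real \<Rightarrow> complex" and E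
    using vector_diff_chain_at[OF l, of f E] s
    by (auto intro: has_vector_derivative_transform_within_open[OF _ S] simp: o_def scaleR_conv_of_real)
  have "sasaki_speed d t = sasaki_norm (d t) (of_real a * fst D) (of_real a * snd D)"
    using d by (intro sasaki_speed_eq t[OF cz] t[OF cw]) auto
  also have "\<dots> = a * sasaki_norm (d t) (fst D) (snd D)" using a by (simp add: sasaki_norm_scale)
  also have "sasaki_norm (d t) (fst D) (snd D) = sasaki_speed c s"
  proof -
    have "d t = c s" using d[OF S(2)] s by simp
    then show ?thesis by (simp add: sasaki_speed_eq[OF cz cw])
  qed
  finally show ?thesis .
qed

lemma sasaki_path_join:
  assumes c: "sasaki_path c" and d: "sasaki_path d" and cd: "pathfinish c = pathstart d"
  shows "sasaki_path (c +++ d)"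
    and "integral {0..1} (sasaki_speed (c +++ d)) = integral {0..1} (sasaki_speed c) + integral {0..1} (sasaki_speed d)"
proof -
  obtain S T where S: "finite S" "\<And>x. x \<in> {0..1} - S \<Longrightarrow> c differentiable at x"
    and T: "finite T" "\<And>x. x \<in> {0..1} - T \<Longrightarrow> d differentiable at x"
    using c d by (auto simp: sasaki_path_def valid_path_def piecewise_C1_differentiable_on_def C1_differentiable_on_eq)
  let ?i = "integral {0..1} (sasaki_speed c)" and ?j = "integral {0..1} (sasaki_speed d)"
  have 1: "(sasaki_speed c has_integral ?i) {0..1}" "(sasaki_speed d has_integral ?j) {0..1}"
    using c d by (auto simp: sasaki_path_def integrable_integral)
  have i: "((\<lambda>x. 2 * sasaki_speed c (2 * x)) has_integral ?i) {0..1/2}"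
   and j: "((\<lambda>x. 2 * sasaki_speed d (2 * x - 1)) has_integral ?j) {1/2..1}"
    using has_integral_affinity01[OF 1(1), where m=2 and c=0, THEN has_integral_cmul[where c=2]]
          has_integral_affinity01[OF 1(2), where m=2 and c="-1", THEN has_integral_cmul[where c=2]]
    by (simp_all only: image_affinity_atLeastAtMost_div_diff) simp_all
  have i': "(sasaki_speed (c +++ d) has_integral ?i) {0..1/2}"
  proof (rule has_integral_spike_finite[OF _ _ i])
    show "finite (insert (1/2) ((\<lambda>x. x / 2) ` S))" using S by simp
    fix x assume x: "x \<in> {0..1/2} - insert (1/2) ((\<lambda>x. x / 2) ` S)"
    then have "2 * x \<notin> S" using image_eqI[of x "\<lambda>x. x / 2" "2 * x" S] by auto
    with x show "sasaki_speed (c +++ d) x = 2 * sasaki_speed c (2 * x)"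
      by (intro sasaki_speed_join[where S="{..<1/2}" and b=0] S) (auto simp: joinpaths_def)
  qed
  have j': "(sasaki_speed (c +++ d) has_integral ?j) {1/2..1}"
  proof (rule has_integral_spike_finite[OF _ _ j])
    show "finite (insert (1/2) ((\<lambda>x. (x + 1) / 2) ` T))" using T by simp
    fix x assume x: "x \<in> {1/2..1} - insert (1/2) ((\<lambda>x. (x + 1) / 2) ` T)"
    then have "2 * x - 1 \<notin> T" using image_eqI[of x "\<lambda>x. (x + 1) / 2" "2 * x - 1" T] by auto
    with x show "sasaki_speed (c +++ d) x = 2 * sasaki_speed d (2 * x - 1)"
      by (intro sasaki_speed_join[where S="{1/2<..}" and b="-1"] T) (auto simp: joinpaths_def)
  qed
  have "(sasaki_speed (c +++ d) has_integral (?i + ?j)) {0..1}"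
    by (rule has_integral_combine[OF _ _ i' j']) auto
  then show "sasaki_path (c +++ d)" "integral {0..1} (sasaki_speed (c +++ d)) = ?i + ?j"
    using c d cd path_image_join_subset[of c d]
    by (auto simp: sasaki_path_def valid_path_join has_integral_integrable integral_unique)
qed

lemma sasaki_dist_eq:
  "sasaki_dist U V = Inf {integral {0..1} (sasaki_speed c) | c. sasaki_path c \<and> pathstart c \<in> U \<and> pathfinish c \<in> V}"
  unfolding sasaki_dist_def sasaki_path_def by (simp add: conj_assoc)

lemma sasaki_length_nonneg: "0 \<le> integral {0..1} (sasaki_speed c)"
  by (cases "sasaki_speed c integrable_on {0..1}")
     (auto intro!: integral_nonneg simp: sasaki_speed_def Let_def not_integrable_integral)

lemma sasaki_dist_le_length:
  assumes "sasaki_path c" "pathstart c \<in> U" "pathfinish c \<in> V"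
  shows "sasaki_dist U V \<le> integral {0..1} (sasaki_speed c)"
  unfolding sasaki_dist_eq using assms
  by (intro cInf_lower bdd_belowI[of _ 0]) (auto simp: sasaki_length_nonneg)

text \<open>By homogeneity the distance between \<open>A\<close> and \<open>A k\<close>, viewed as vectors, is controlled by \<open>k\<close>
  alone, however far away \<open>A\<close> is.\<close>

lemma sasaki_dist_le_displacement:
  assumes "det A = 1" "det k = 1" "SL2R_act A (\<i>, \<i>) \<in> U" "SL2R_act (A ** k) (\<i>, \<i>) \<in> V"
  shows "sasaki_dist U V \<le> displacement (SL2R_act k (\<i>, \<i>))"
proof -
  have "SL2R_act k (\<i>, \<i>) \<in> T1H2" using assms by (intro SL2R_act_T1H2) (auto simp: T1H2_iff)
  from short_path[OF assms(1) this] obtain c where c: "sasaki_path c" "pathstart c = SL2R_act A (\<i>, \<i>)"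
    "pathfinish c = SL2R_act A (SL2R_act k (\<i>, \<i>))"
    "integral {0..1} (sasaki_speed c) \<le> displacement (SL2R_act k (\<i>, \<i>))" .
  have "sasaki_dist U V \<le> integral {0..1} (sasaki_speed c)"
    using c assms by (intro sasaki_dist_le_length) (simp_all add: SL2R_act_mult)
  with c show ?thesis by simp
qed

lemma sasaki_path_exists:
  assumes "U \<subseteq> T1H2" "V \<subseteq> T1H2" "U \<noteq> {}" "V \<noteq> {}"
  shows "\<exists>c. sasaki_path c \<and> pathstart c \<in> U \<and> pathfinish c \<in> V"
proof -
  have rep: "\<exists>A. det A = 1 \<and> SL2R_act A (\<i>, \<i>) \<in> W" if W: "W \<subseteq> T1H2" "W \<noteq> {}" for W
  proof -
    obtain x where x: "x \<in> W" "x \<in> T1H2" using W by blast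
    show ?thesis by (rule SL2R_transitive[OF x(2)]) (use x in auto)
  qed
  obtain A B where AB: "det A = 1" "SL2R_act A (\<i>, \<i>) \<in> U" "det B = 1" "SL2R_act B (\<i>, \<i>) \<in> V"
    using rep[OF assms(1,3)] rep[OF assms(2,4)] by auto
  have T: "SL2R_act (inv2 A) (SL2R_act B (\<i>, \<i>)) \<in> T1H2"
    by (rule SL2R_act_T1H2[OF inv2(1)[OF AB(1)] subsetD[OF assms(2) AB(4)]])
  have "Im (fst (SL2R_act B (\<i>, \<i>))) > 0" using subsetD[OF assms(2) AB(4)] unfolding T1H2_iff by blast
  then have eq: "SL2R_act A (SL2R_act (inv2 A) (SL2R_act B (\<i>, \<i>))) = SL2R_act B (\<i>, \<i>)"
    by (rule act_inv2(1)[OF AB(1)])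
  show ?thesis
    by (rule short_path[OF AB(1) T], unfold eq) (use AB in auto)
qed

lemma sasaki_dist_nonneg:
  assumes "U \<subseteq> T1H2" "V \<subseteq> T1H2" "U \<noteq> {}" "V \<noteq> {}"
  shows "0 \<le> sasaki_dist U V"
  unfolding sasaki_dist_eq using sasaki_path_exists[OF assms]
  by (intro cInf_greatest) (auto simp: sasaki_length_nonneg)

text \<open>The instance of the triangle inequality needed to see that strong stable sets are invariant under
  the horocyclic flow. Only the second of the two paths that are joined is moved by an isometry, and it is an
  explicit smooth one.\<close>

lemma sasaki_dist_step:
  assumes UV: "U \<subseteq> T1H2" "V \<subseteq> T1H2" "U \<noteq> {}" "V \<noteq> {}" and k: "det k = 1"
    and step: "\<And>A. det A = 1 \<Longrightarrow> SL2R_act A (\<i>, \<i>) \<in> V \<Longrightarrow> SL2R_act (A ** k) (\<i>, \<i>) \<in> V'"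
  shows "sasaki_dist U V' \<le> sasaki_dist U V + displacement (SL2R_act k (\<i>, \<i>))"
proof -
  have "sasaki_dist U V' - displacement (SL2R_act k (\<i>, \<i>)) \<le> sasaki_dist U V"
    unfolding sasaki_dist_eq[of U V]
  proof (rule cInf_greatest)
    show "{integral {0..1} (sasaki_speed c) |c. sasaki_path c \<and> pathstart c \<in> U \<and> pathfinish c \<in> V} \<noteq> {}"
      using sasaki_path_exists[OF UV] by auto
    fix x assume "x \<in> {integral {0..1} (sasaki_speed c) |c. sasaki_path c \<and> pathstart c \<in> U \<and> pathfinish c \<in> V}"
    then obtain c where x: "x = integral {0..1} (sasaki_speed c)" and c: "sasaki_path c" "pathstart c \<in> U" "pathfinish c \<in> V"
      by auto
    have "pathfinish c \<in> T1H2" using c UV by blast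
    from SL2R_transitive[OF this] obtain A where A: "det A = 1" "pathfinish c = SL2R_act A (\<i>, \<i>)" .
    have kT: "SL2R_act k (\<i>, \<i>) \<in> T1H2" using k by (intro SL2R_act_T1H2) (auto simp: T1H2_iff)
    from short_path[OF A(1) this] obtain d where d: "sasaki_path d" "pathstart d = SL2R_act A (\<i>, \<i>)"
      "pathfinish d = SL2R_act A (SL2R_act k (\<i>, \<i>))"
      "integral {0..1} (sasaki_speed d) \<le> displacement (SL2R_act k (\<i>, \<i>))" .
    have cd: "pathfinish c = pathstart d" using A d by simp
    have "pathfinish d \<in> V'" using d step[of A] c A k by (simp add: SL2R_act_mult)
    then have "sasaki_dist U V' \<le> integral {0..1} (sasaki_speed (c +++ d))"
      using c sasaki_path_join(1)[OF c(1) d(1) cd] by (intro sasaki_dist_le_length) auto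
    then show "sasaki_dist U V' - displacement (SL2R_act k (\<i>, \<i>)) \<le> x"
      using sasaki_path_join(2)[OF c(1) d(1) cd] d x by simp
  qed
  then show ?thesis by simp
qed



section \<open>Two by two matrices\<close>

lemma matrix2_eqI:
  "A$1$1 = B$1$1 \<Longrightarrow> A$1$2 = B$1$2 \<Longrightarrow> A$2$1 = B$2$1 \<Longrightarrow> A$2$2 = B$2$2 \<Longrightarrow> A = (B::real^2^2)"
  by (simp add: vec_eq_iff forall_2)

lemma matrix_mult_2: "((A::real^2^2) ** B)$i$j = A$i$1 * B$1$j + A$i$2 * B$2$j"
  by (simp add: matrix_matrix_mult_def sum_2)

lemma inv2_mult: "inv2 (A ** B) = inv2 B ** inv2 A"
  by (rule matrix2_eqI) (simp_all add: inv2_def matrix_mult_2 algebra_simps)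

lemma inv2_one: "inv2 (mat 1) = mat 1"
  by (rule matrix2_eqI) (simp_all add: inv2_def mat_def)

text \<open>The sum of the absolute values is submultiplicative and, unlike the operator norm, visibly
  invariant under inversion in \<open>SL(2,R)\<close>.\<close>

definition entry_norm :: "real^2^2 \<Rightarrow> real" where
  "entry_norm A = \<bar>A$1$1\<bar> + \<bar>A$1$2\<bar> + \<bar>A$2$1\<bar> + \<bar>A$2$2\<bar>"

lemma entry_norm_nonneg: "0 \<le> entry_norm A"
  by (simp add: entry_norm_def)

lemma entry_norm_mult: "entry_norm (A ** B) \<le> entry_norm A * entry_norm B"
proof -
  have t: "\<bar>x * y + z * w\<bar> \<le> \<bar>x\<bar> * \<bar>y\<bar> + \<bar>z\<bar> * \<bar>w\<bar>" for x y z w :: real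
    by (metis abs_mult abs_triangle_ineq)
  have "entry_norm (A ** B) \<le>
     (\<bar>A$1$1\<bar> * \<bar>B$1$1\<bar> + \<bar>A$1$2\<bar> * \<bar>B$2$1\<bar>) + (\<bar>A$1$1\<bar> * \<bar>B$1$2\<bar> + \<bar>A$1$2\<bar> * \<bar>B$2$2\<bar>) +
     (\<bar>A$2$1\<bar> * \<bar>B$1$1\<bar> + \<bar>A$2$2\<bar> * \<bar>B$2$1\<bar>) + (\<bar>A$2$1\<bar> * \<bar>B$1$2\<bar> + \<bar>A$2$2\<bar> * \<bar>B$2$2\<bar>)"
    unfolding entry_norm_def matrix_matrix_mult_def by (simp add: sum_2) (intro add_mono t)
  also have "\<dots> \<le> (\<bar>A$1$1\<bar> + \<bar>A$1$2\<bar> + \<bar>A$2$1\<bar> + \<bar>A$2$2\<bar>) * (\<bar>B$1$1\<bar> + \<bar>B$1$2\<bar> + \<bar>B$2$1\<bar> + \<bar>B$2$2\<bar>)"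
    by (simp add: distrib_left distrib_right add_nonneg_nonneg)
  finally show ?thesis by (simp add: entry_norm_def)
qed

lemma entry_norm_inv2: "entry_norm (inv2 A) = entry_norm A"
  by (simp add: entry_norm_def inv2_def)

lemma entry_norm_one: "entry_norm (mat 1) = 2"
  by (simp add: entry_norm_def mat_def)

lemma norm_vec2_le: "norm (x::real^2) \<le> \<bar>x$1\<bar> + \<bar>x$2\<bar>"
  using norm_le_l1_cart[of x] by (simp add: sum_2)

lemma matrix_vector_2: "((A::real^2^2) *v x)$i = A$i$1 * x$1 + A$i$2 * x$2"
  by (simp add: matrix_vector_mult_def sum_2)

lemma norm_matrix_vector: "norm ((A::real^2^2) *v x) \<le> entry_norm A * norm x"
proof -
  have c: "\<bar>x$i\<bar> \<le> norm x" for i by (rule component_le_norm_cart)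
  have "\<bar>(A *v x)$i\<bar> \<le> (\<bar>A$i$1\<bar> + \<bar>A$i$2\<bar>) * norm x" for i
  proof -
    have "\<bar>(A *v x)$i\<bar> \<le> \<bar>A$i$1\<bar> * \<bar>x$1\<bar> + \<bar>A$i$2\<bar> * \<bar>x$2\<bar>"
      unfolding matrix_vector_2 by (metis abs_mult abs_triangle_ineq)
    also have "\<dots> \<le> \<bar>A$i$1\<bar> * norm x + \<bar>A$i$2\<bar> * norm x" by (intro add_mono mult_left_mono c) auto
    finally show ?thesis by (simp add: distrib_right)
  qed
  from this[of 1] this[of 2] norm_vec2_le[of "A *v x"] show ?thesis
    by (simp add: entry_norm_def distrib_right)
qed

lemma entry_le_dist: "\<bar>A$i$j - B$i$j\<bar> \<le> dist (A::real^2^2) B"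
  using component_le_norm_cart[of "(A - B)$i" j] Finite_Cartesian_Product.norm_nth_le[of "A - B" i]
  by (simp add: dist_norm)

lemma dist_le_entries: "dist (A::real^2^2) B \<le> entry_norm (A - B)"
proof -
  have "norm (A - B) \<le> (\<Sum>i\<in>UNIV. norm ((A - B)$i))"
    unfolding norm_vec_def by (rule L2_set_le_sum) simp
  also have "\<dots> \<le> entry_norm (A - B)"
    using norm_vec2_le[of "(A - B)$1"] norm_vec2_le[of "(A - B)$2"] by (simp add: sum_2 entry_norm_def)
  finally show ?thesis by (simp add: dist_norm)
qed

abbreviation e1 :: "real^2" where "e1 \<equiv> axis 1 1"

lemma e1_nth: "e1$1 = 1" "e1$2 = 0" by (simp_all add: axis_def)

text \<open>Conjugation by the diagonal matrix that generates the geodesic flow: an element \<open>h\<close> for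
  which it is close to 1 moves the vertical vector at height \<open>exp t\<close> only a little.\<close>

definition geo_conj :: "real \<Rightarrow> real^2^2 \<Rightarrow> real^2^2" where
  "geo_conj t A = M2 (A$1$1) (exp (- t) * A$1$2) (exp t * A$2$1) (A$2$2)"

section \<open>Infinite products of sparse elements\<close>

locale sl2_group =
  fixes H :: "(real^2^2) set"
  assumes det: "A \<in> H \<Longrightarrow> det A = 1"
    and one: "mat 1 \<in> H"
    and mult: "A \<in> H \<Longrightarrow> B \<in> H \<Longrightarrow> A ** B \<in> H"
    and inv: "A \<in> H \<Longrightarrow> inv2 A \<in> H"

text \<open>
  Elements \<open>h k\<close> of the group that are within \<open>\<delta> k / B k\<close> of 1 as seen from height \<open>exp (t k)\<close>.
  The number \<open>B k\<close> bounds the norm of every product of some of the earlier elements, so that multiplying such a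
  product by \<open>h k\<close> costs \<open>O(\<delta> k)\<close>. The lower bound for \<open>t k\<close> makes \<open>exp (- t k)\<close> at most
  \<open>\<delta> k / B k\<close>. The next tolerance is small in comparison with everything that
  \<open>h k\<close> and \<open>t k\<close> can magnify, and also in comparison with the distance by which \<open>h k\<close> moves
  \<open>e1\<close>, so that later factors cannot undo the effect of \<open>h k\<close>.
\<close>

locale sparse_crossings = sl2_group +
  fixes B \<delta> t :: "nat \<Rightarrow> real" and h :: "nat \<Rightarrow> real^2^2"
  assumes B: "2 \<le> B k" and \<delta>: "0 < \<delta> k" "\<delta> k \<le> 1/8"
    and h: "h k \<in> H" and t: "B k / \<delta> k \<le> t k"
    and near: "dist (geo_conj (t k) (h k)) (mat 1) < \<delta> k / B k"
    and B_Suc: "B (Suc k) = B k * (1 + entry_norm (h k))"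
    and \<delta>_Suc: "\<delta> (Suc k) \<le> \<delta> k / 2" "\<delta> (Suc k) * exp (t k) \<le> \<delta> k"
      "0 < norm (h k *v e1 - e1)"
      "\<delta> (Suc k) * (16 * (1 + entry_norm (h k))) \<le> norm (h k *v e1 - e1)"

text \<open>Each element is chosen after the tolerance that it has to meet, by dependent choice on the quadruple
  \<open>(B k, \<delta> k, t k, h k)\<close>.\<close>

lemma (in sl2_group) sparse_crossings_exist:
  assumes short: "\<And>\<eta>. \<eta> > 0 \<Longrightarrow> \<exists>h\<in>H. \<exists>t\<ge>1/\<eta>. dist (geo_conj t h) (mat 1) < \<eta> \<and> h *v e1 \<noteq> e1"
  shows "\<exists>B \<delta> t h. sparse_crossings H B \<delta> t h"
proof -
  define P where "P = (\<lambda>n::nat. \<lambda>(B, \<delta>, t, h). 2 \<le> B \<and> 0 < \<delta> \<and> \<delta> \<le> 1/8 \<and> h \<in> H \<and> B / \<delta> \<le> t \<and>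
     dist (geo_conj t h) (mat 1) < \<delta> / B \<and> h *v e1 \<noteq> e1)"
  define Q where "Q = (\<lambda>n::nat. \<lambda>(B, \<delta>, t, h) (B', \<delta>' :: real, t' :: real, h' :: real^2^2).
     B' = B * (1 + entry_norm h) \<and> \<delta>' \<le> \<delta> / 2 \<and> \<delta>' * exp t \<le> \<delta> \<and>
     \<delta>' * (16 * (1 + entry_norm h)) \<le> norm (h *v e1 - e1))"
  have ex: "\<exists>t h. P n (B, \<delta>, t, h)" if "2 \<le> B" "0 < \<delta>" "\<delta> \<le> 1/8" for B \<delta> n
    using short[of "\<delta> / B"] that by (auto simp: P_def)
  have "\<exists>f. \<forall>n. P n (f n) \<and> Q n (f n) (f (Suc n))"
  proof (rule dependent_nat_choice)
    show "\<exists>x. P 0 x" using ex[of 2 "1/8" 0] by auto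
    fix x n assume "P n x"
    then obtain B \<delta> t h where x: "x = (B, \<delta>, t, h)" and B: "2 \<le> B" and \<delta>: "0 < \<delta>" "\<delta> \<le> 1/8" and h: "h *v e1 \<noteq> e1"
      by (cases x) (auto simp: P_def)
    let ?D = "norm (h *v e1 - e1)" and ?N = "16 * (1 + entry_norm h)"
    define \<delta>' where "\<delta>' = min (\<delta> / 2) (min (\<delta> / exp t) (?D / ?N))"
    have N: "?N > 0" using entry_norm_nonneg[of h] by simp
    have d: "0 < \<delta>'" "\<delta>' \<le> 1/8" using \<delta> h N by (auto simp: \<delta>'_def)
    have d0: "\<delta>' \<le> \<delta> / 2" unfolding \<delta>'_def by (rule min.cobounded1)
    have "\<delta>' \<le> \<delta> / exp t" by (auto simp: \<delta>'_def)
    then have d2: "\<delta>' * exp t \<le> \<delta>" by (simp add: pos_le_divide_eq)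
    have "\<delta>' * ?N \<le> (?D / ?N) * ?N" using N by (intro mult_right_mono) (auto simp: \<delta>'_def)
    then have d3: "\<delta>' * ?N \<le> ?D" using N by simp
    have "2 * 1 \<le> B * (1 + entry_norm h)" using B entry_norm_nonneg[of h] by (intro mult_mono) auto
    then obtain t' h' where "P (Suc n) (B * (1 + entry_norm h), \<delta>', t', h')" using ex d by fastforce
    moreover have "Q n x (B * (1 + entry_norm h), \<delta>', t', h')"
      using d2 d3 d0 by (simp add: Q_def x)
    ultimately show "\<exists>y. P (Suc n) y \<and> Q n x y" by blast
  qed
  then obtain f where f: "\<And>n. P n (f n)" "\<And>n. Q n (f n) (f (Suc n))" by blast
  have "sparse_crossings H (\<lambda>n. fst (f n)) (\<lambda>n. fst (snd (f n))) (\<lambda>n. fst (snd (snd (f n)))) (\<lambda>n. snd (snd (snd (f n))))"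
    using f by unfold_locales (auto simp: P_def Q_def case_prod_beta)
  then show ?thesis by blast
qed

lemma geometric_steps_converge:
  fixes X :: "nat \<Rightarrow> 'a::banach"
  assumes "\<And>j. norm (X (Suc j) - X j) \<le> a / 2 ^ j"
  shows "\<exists>L. X \<longlonglongrightarrow> L \<and> norm (L - X 0) \<le> 2 * a"
proof -
  have "(\<lambda>j. a * (1/2) ^ j) sums (a * (1 / (1 - 1/2)))"
    by (intro sums_mult geometric_sums) auto
  then have g: "(\<lambda>j. a / 2 ^ j) sums (2 * a)" by (simp add: power_one_over mult.commute)
  then have gs: "summable (\<lambda>j. a / 2 ^ j)" by (rule sums_summable)
  have s: "summable (\<lambda>j. norm (X (Suc j) - X j))"
  proof (rule summable_comparison_test')
    show "summable (\<lambda>j. a / 2 ^ j)" by (fact gs)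
    show "norm (norm (X (Suc n) - X n)) \<le> a / 2 ^ n" if "0 \<le> n" for n unfolding real_norm_def abs_norm_cancel by (rule assms)
  qed
  have "summable (\<lambda>j. X (Suc j) - X j)" by (rule summable_norm_cancel[OF s])
  then have "(\<lambda>j. X (Suc j) - X j) sums (\<Sum>j. X (Suc j) - X j)" by (rule summable_sums)
  then have "(\<lambda>n. X n - X 0) \<longlonglongrightarrow> (\<Sum>j. X (Suc j) - X j)"
    unfolding sums_def sum_lessThan_telescope .
  then have "(\<lambda>n. X 0 + (X n - X 0)) \<longlonglongrightarrow> X 0 + (\<Sum>j. X (Suc j) - X j)"
    by (intro tendsto_add tendsto_const)
  then have 1: "X \<longlonglongrightarrow> X 0 + (\<Sum>j. X (Suc j) - X j)" by simp
  have "norm (\<Sum>j. X (Suc j) - X j) \<le> (\<Sum>j. norm (X (Suc j) - X j))" by (rule summable_norm[OF s])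
  also have "\<dots> \<le> (\<Sum>j. a / 2 ^ j)" by (intro suminf_le assms s gs)
  also have "\<dots> = 2 * a" using g by (rule sums_unique[symmetric])
  finally have "norm (X 0 + (\<Sum>j. X (Suc j) - X j) - X 0) \<le> 2 * a" by simp
  with 1 show ?thesis by blast
qed

context sparse_crossings begin

lemma t_nonneg: "0 \<le> t k"
  using t[of k] B[of k] \<delta>(1)[of k] by (meson divide_nonneg_pos order_trans zero_le_numeral)

lemma eta_le_delta: "\<delta> k / B k \<le> \<delta> k"
  using B[of k] \<delta>(1)[of k] by (simp add: divide_le_eq)

lemma h_entries:
  "\<bar>h k$1$1 - 1\<bar> < \<delta> k / B k" "\<bar>h k$2$2 - 1\<bar> < \<delta> k / B k"
  "exp (- t k) * \<bar>h k$1$2\<bar> < \<delta> k / B k" "exp (t k) * \<bar>h k$2$1\<bar> < \<delta> k / B k"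
  using entry_le_dist[of "geo_conj (t k) (h k)" 1 1 "mat 1"] entry_le_dist[of "geo_conj (t k) (h k)" 2 2 "mat 1"]
    entry_le_dist[of "geo_conj (t k) (h k)" 1 2 "mat 1"] entry_le_dist[of "geo_conj (t k) (h k)" 2 1 "mat 1"] near[of k]
  by (auto simp: geo_conj_def mat_def abs_mult)

lemma delta_decay: "\<delta> (k + j) \<le> \<delta> k / 2 ^ j"
proof (induction j)
  case (Suc j)
  have "\<delta> (k + Suc j) \<le> (\<delta> k / 2 ^ j) / 2" using \<delta>_Suc(1)[of "k + j"] Suc by simp
  then show ?case by simp
qed simp

definition factor :: "(nat \<Rightarrow> bool) \<Rightarrow> nat \<Rightarrow> real^2^2" where
  "factor \<epsilon> k = (if \<epsilon> k then h k else mat 1)"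

primrec block :: "(nat \<Rightarrow> bool) \<Rightarrow> nat \<Rightarrow> nat \<Rightarrow> real^2^2" where
  "block \<epsilon> k 0 = mat 1"
| "block \<epsilon> k (Suc j) = block \<epsilon> k j ** factor \<epsilon> (k + j)"

lemma factor_H: "factor \<epsilon> k \<in> H" by (simp add: factor_def h one)

lemma block_H: "block \<epsilon> k j \<in> H" by (induction j) (simp_all add: one mult factor_H)

lemma block_shift: "block \<epsilon> k (Suc j) = factor \<epsilon> k ** block \<epsilon> (Suc k) j"
  by (induction j) (simp_all add: matrix_mul_assoc)

lemma block_norm: "entry_norm (block \<epsilon> k j) \<le> B (k + j)"
proof (induction j)
  case 0 then show ?case using B by (simp add: entry_norm_one)
next
  case (Suc j)
  have "entry_norm (block \<epsilon> k (Suc j)) \<le> entry_norm (block \<epsilon> k j) * (1 + entry_norm (h (k + j)))"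
    using entry_norm_mult[of "block \<epsilon> k j" "h (k + j)"] entry_norm_nonneg[of "block \<epsilon> k j"]
      entry_norm_nonneg[of "h (k + j)"]
    by (auto simp: factor_def distrib_left)
  also have "\<dots> \<le> B (k + j) * (1 + entry_norm (h (k + j)))"
    using Suc entry_norm_nonneg[of "h (k + j)"] by (intro mult_right_mono) auto
  finally show ?case by (simp add: B_Suc)
qed

lemma factor_e1: "norm (factor \<epsilon> k *v e1 - e1) \<le> 2 * \<delta> k / B k"
proof (cases "\<epsilon> k")
  case True
  have "\<bar>h k$2$1\<bar> \<le> exp (t k) * \<bar>h k$2$1\<bar>" using t_nonneg[of k] by (simp add: mult_le_cancel_right1)
  then have "\<bar>(h k *v e1 - e1)$1\<bar> + \<bar>(h k *v e1 - e1)$2\<bar> \<le> 2 * \<delta> k / B k"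
    using h_entries[of k] by (simp add: matrix_vector_2 e1_nth)
  then show ?thesis using norm_vec2_le[of "h k *v e1 - e1"] True by (simp add: factor_def)
next
  case False
  then show ?thesis using B[of k] \<delta>(1)[of k] by (simp add: factor_def)
qed

lemma block_e1_step: "norm (block \<epsilon> k (Suc j) *v e1 - block \<epsilon> k j *v e1) \<le> (2 * \<delta> k) / 2 ^ j"
proof -
  have b: "B (k + j) > 0" using B[of "k + j"] by linarith
  have "block \<epsilon> k (Suc j) *v e1 - block \<epsilon> k j *v e1 = block \<epsilon> k j *v (factor \<epsilon> (k + j) *v e1 - e1)"
    by (simp add: matrix_vector_mult_diff_distrib matrix_vector_mul_assoc)
  also have "norm \<dots> \<le> entry_norm (block \<epsilon> k j) * norm (factor \<epsilon> (k + j) *v e1 - e1)"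
    by (rule norm_matrix_vector)
  also have "\<dots> \<le> B (k + j) * (2 * \<delta> (k + j) / B (k + j))"
    by (intro mult_mono block_norm factor_e1) (use b in auto)
  also have "\<dots> = 2 * \<delta> (k + j)" using b by simp
  finally show ?thesis using delta_decay[of k j] by simp
qed

text \<open>
  The products themselves diverge: the upper right entry of \<open>h k\<close> may be as large as
  \<open>\<delta> k * exp (t k)\<close>. Their first columns converge, however, and a first column is all that a horocyclic orbit
  remembers, since \<open>e1\<close> is fixed by the unipotent matrices of the horocyclic flow.
\<close>

definition first_col :: "(nat \<Rightarrow> bool) \<Rightarrow> nat \<Rightarrow> real^2" where
  "first_col \<epsilon> k = lim (\<lambda>j. block \<epsilon> k j *v e1)"

lemma first_col:
  shows first_col_lim: "(\<lambda>j. block \<epsilon> k j *v e1) \<longlonglongrightarrow> first_col \<epsilon> k"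
    and first_col_near: "norm (first_col \<epsilon> k - e1) \<le> 4 * \<delta> k"
proof -
  obtain L where L: "(\<lambda>j. block \<epsilon> k j *v e1) \<longlonglongrightarrow> L" "norm (L - e1) \<le> 4 * \<delta> k"
    using geometric_steps_converge[of "\<lambda>j. block \<epsilon> k j *v e1", OF block_e1_step] by auto
  have eq: "first_col \<epsilon> k = L" unfolding first_col_def by (rule limI[OF L(1)])
  show "(\<lambda>j. block \<epsilon> k j *v e1) \<longlonglongrightarrow> first_col \<epsilon> k" "norm (first_col \<epsilon> k - e1) \<le> 4 * \<delta> k"
    unfolding eq by (fact L)+
qed

lemma first_col_Suc: "first_col \<epsilon> k = factor \<epsilon> k *v first_col \<epsilon> (Suc k)"
proof -
  have 1: "(\<lambda>j. block \<epsilon> k (Suc j) *v e1) \<longlonglongrightarrow> first_col \<epsilon> k"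
    using LIMSEQ_Suc[OF first_col_lim[of \<epsilon> k]] .
  have "isCont ((*v) (factor \<epsilon> k)) (first_col \<epsilon> (Suc k))"
    by (rule matrix_vector_mult_linear_continuous_at)
  from isCont_tendsto_compose[OF this first_col_lim]
  have 2: "(\<lambda>j. block \<epsilon> k (Suc j) *v e1) \<longlonglongrightarrow> factor \<epsilon> k *v first_col \<epsilon> (Suc k)"
    unfolding block_shift by (simp only: matrix_vector_mul_assoc)
  show ?thesis by (rule LIMSEQ_unique[OF 1 2])
qed

lemma first_col_block: "first_col \<epsilon> 0 = block \<epsilon> 0 k *v first_col \<epsilon> k"
proof (induction k)
  case (Suc k)
  then show ?case by (subst (asm) (2) first_col_Suc) (simp add: matrix_vector_mul_assoc)
qed simp

text \<open>If two choices first differ at \<open>k\<close>, the earlier factors cancel, and equality would mean that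
  \<open>h k\<close> maps one vector close to \<open>e1\<close> to another. This is excluded because both are within
  \<open>4 * \<delta> (k + 1)\<close> of \<open>e1\<close>, far less than the distance by which \<open>h k\<close> moves \<open>e1\<close>.\<close>

lemma first_col_inj: "inj (\<lambda>\<epsilon>. first_col \<epsilon> 0)"
proof (rule injI, rule ccontr)
  have main: False if eq: "first_col \<epsilon> 0 = first_col \<epsilon>' 0" and k: "\<epsilon> k" "\<not> \<epsilon>' k" "\<And>j. j < k \<Longrightarrow> \<epsilon> j = \<epsilon>' j" for \<epsilon> \<epsilon>' k
  proof -
    have "block \<epsilon> 0 j = block \<epsilon>' 0 j" if "j \<le> k" for j
      using that by (induction j) (auto simp: factor_def k(3))
    then have "block \<epsilon> 0 k *v first_col \<epsilon> k = block \<epsilon> 0 k *v first_col \<epsilon>' k"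
      using eq first_col_block[of _ k] by simp
    then have "(inv2 (block \<epsilon> 0 k) ** block \<epsilon> 0 k) *v first_col \<epsilon> k = (inv2 (block \<epsilon> 0 k) ** block \<epsilon> 0 k) *v first_col \<epsilon>' k"
      by (metis matrix_vector_mul_assoc)
    then have "first_col \<epsilon> k = first_col \<epsilon>' k" using inv2(2)[OF det[OF block_H]] by simp
    then have hy: "h k *v first_col \<epsilon> (Suc k) = first_col \<epsilon>' (Suc k)"
      using first_col_Suc[of \<epsilon> k] first_col_Suc[of \<epsilon>' k] k by (simp add: factor_def)
    have eq': "h k *v e1 - e1 = h k *v (e1 - first_col \<epsilon> (Suc k)) + (first_col \<epsilon>' (Suc k) - e1)"
      by (simp add: matrix_vector_mult_diff_distrib hy)
    have "norm (h k *v e1 - e1) \<le> norm (h k *v (e1 - first_col \<epsilon> (Suc k))) + norm (first_col \<epsilon>' (Suc k) - e1)"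
      unfolding eq' by (rule norm_triangle_ineq)
    also have "\<dots> \<le> entry_norm (h k) * (4 * \<delta> (Suc k)) + 4 * \<delta> (Suc k)"
      using norm_matrix_vector[of "h k" "e1 - first_col \<epsilon> (Suc k)"] first_col_near[of \<epsilon> "Suc k"]
        mult_left_mono[OF first_col_near[of \<epsilon> "Suc k"] entry_norm_nonneg[of "h k"]]
      by (intro add_mono first_col_near) (simp add: norm_minus_commute)
    also have "\<dots> = \<delta> (Suc k) * (16 * (1 + entry_norm (h k))) / 4" by (simp add: algebra_simps)
    also have "\<dots> \<le> norm (h k *v e1 - e1) / 4" using \<delta>_Suc(4)[of k] by simp
    finally show False using \<delta>_Suc(3)[of k] by simp
  qed
  fix \<epsilon> \<epsilon>' assume eq: "first_col \<epsilon> 0 = first_col \<epsilon>' 0" and "\<epsilon> \<noteq> \<epsilon>'"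
  then obtain n where "\<epsilon> n \<noteq> \<epsilon>' n" by blast
  then obtain k where k: "\<epsilon> k \<noteq> \<epsilon>' k" "\<And>j. j < k \<Longrightarrow> \<epsilon> j = \<epsilon>' j"
    using exists_least_iff[of "\<lambda>n. \<epsilon> n \<noteq> \<epsilon>' n"] by blast
  then show False using main[OF eq, of k] main[OF eq[symmetric], of k] by metis
qed

lemma first_col_entry: "1/2 \<le> first_col \<epsilon> k$1" "first_col \<epsilon> k$1 \<le> 3/2"
  using component_le_norm_cart[of "first_col \<epsilon> k - e1" 1] first_col_near[of \<epsilon> k] \<delta>(2)[of k]
  by (auto simp: e1_nth)

text \<open>Any other second column that gives determinant 1 would do: it only selects another point of the
  same horocyclic orbit.\<close>

definition limit_mat :: "(nat \<Rightarrow> bool) \<Rightarrow> real^2^2" where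
  "limit_mat \<epsilon> = M2 (first_col \<epsilon> 0$1) 0 (first_col \<epsilon> 0$2) (1 / first_col \<epsilon> 0$1)"

lemma limit_mat: "det (limit_mat \<epsilon>) = 1" "limit_mat \<epsilon> *v e1 = first_col \<epsilon> 0"
  using first_col_entry(1)[of \<epsilon> 0]
  by (auto simp: limit_mat_def det_2 vec_eq_iff forall_2 matrix_vector_2 e1_nth)

text \<open>
  Between the times \<open>t k\<close> and \<open>t (k + 1)\<close> the limit follows the translate by the product of the factors
  up to \<open>k\<close>. The conjugation expands the lower left entry, which is harmless up to time \<open>t (k + 1)\<close> because
  the next factor is nearly 1 at that time and the later ones are negligible; it contracts the upper right entry, which
  from time \<open>t k\<close> on outweighs the size \<open>\<delta> k * exp (t k)\<close> that the factor \<open>h k\<close> has introduced. The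
  determinant takes care of the remaining entry.
\<close>

lemma limit_mat_close:
  assumes s: "t k \<le> s" "s \<le> t (Suc k)"
  shows "dist (geo_conj s (inv2 (block \<epsilon> 0 (Suc k)) ** limit_mat \<epsilon>)) (mat 1) \<le> 50 * \<delta> k"
proof -
  define M where "M = inv2 (block \<epsilon> 0 (Suc k)) ** limit_mat \<epsilon>"
  let ?d = "\<delta> k" and ?d' = "\<delta> (Suc k)"
  have d': "?d' \<le> ?d / 2" "0 < ?d'" "0 < ?d" "?d \<le> 1/8" using \<delta>_Suc(1) \<delta> by auto
  have detM: "det M = 1"
    unfolding M_def det_mul using inv2(1)[OF det[OF block_H[of \<epsilon> 0 "Suc k"]]] limit_mat(1)
    by (simp del: block.simps)
  have "M *v e1 = first_col \<epsilon> (Suc k)"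
  proof -
    have "M *v e1 = (inv2 (block \<epsilon> 0 (Suc k)) ** block \<epsilon> 0 (Suc k)) *v first_col \<epsilon> (Suc k)"
      using first_col_block[of \<epsilon> "Suc k"]
      by (simp add: M_def limit_mat(2) flip: matrix_vector_mul_assoc del: block.simps)
    then show ?thesis using inv2(2)[OF det[OF block_H]] by (simp del: block.simps)
  qed
  then have col: "M$i$1 = first_col \<epsilon> (Suc k)$i" for i
    by (metis matrix_vector_2 e1_nth mult.right_neutral mult_zero_right add.right_neutral)
  have M11: "\<bar>M$1$1 - 1\<bar> \<le> 2 * ?d"
    using component_le_norm_cart[of "first_col \<epsilon> (Suc k) - e1" 1] first_col_near[of \<epsilon> "Suc k"] d'
    by (simp add: col e1_nth)
  have low: "exp (t j) * \<bar>first_col \<epsilon> j$2\<bar> \<le> 10 * \<delta> j" for j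
  proof -
    have "\<bar>first_col \<epsilon> (Suc j)$2\<bar> \<le> 4 * \<delta> (Suc j)"
      using component_le_norm_cart[of "first_col \<epsilon> (Suc j) - e1" 2] first_col_near[of \<epsilon> "Suc j"] by (simp add: e1_nth)
    then have "exp (t j) * \<bar>first_col \<epsilon> (Suc j)$2\<bar> \<le> exp (t j) * (4 * \<delta> (Suc j))"
      by (intro mult_left_mono) auto
    also have "\<dots> = 4 * (\<delta> (Suc j) * exp (t j))" by simp
    also have "\<dots> \<le> 4 * \<delta> j" using \<delta>_Suc(2)[of j] by simp
    finally have y: "exp (t j) * \<bar>first_col \<epsilon> (Suc j)$2\<bar> \<le> 4 * \<delta> j" .
    show ?thesis
    proof (cases "\<epsilon> j")
      case False
      then show ?thesis using y \<delta>(1)[of j] first_col_Suc[of \<epsilon> j] by (simp add: factor_def)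
    next
      case True
      let ?c = "first_col \<epsilon> (Suc j)"
      have "first_col \<epsilon> j$2 = h j$2$1 * ?c$1 + h j$2$2 * ?c$2"
        using True first_col_Suc[of \<epsilon> j] by (simp add: factor_def matrix_vector_2)
      then have "exp (t j) * \<bar>first_col \<epsilon> j$2\<bar> \<le> exp (t j) * (\<bar>h j$2$1\<bar> * \<bar>?c$1\<bar> + \<bar>h j$2$2\<bar> * \<bar>?c$2\<bar>)"
        by (intro mult_left_mono) (auto simp: abs_mult[symmetric])
      also have "\<dots> = (exp (t j) * \<bar>h j$2$1\<bar>) * \<bar>?c$1\<bar> + \<bar>h j$2$2\<bar> * (exp (t j) * \<bar>?c$2\<bar>)"
        by (simp add: algebra_simps)
      also have "\<dots> \<le> \<delta> j * (3/2) + (3/2) * (4 * \<delta> j)"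
      proof (rule add_mono; rule mult_mono)
        show "exp (t j) * \<bar>h j$2$1\<bar> \<le> \<delta> j" using h_entries(4)[of j] eta_le_delta[of j] by linarith
        show "\<bar>?c$1\<bar> \<le> 3/2" using first_col_entry[of \<epsilon> "Suc j"] by linarith
        show "\<bar>h j$2$2\<bar> \<le> 3/2" using h_entries(2)[of j] eta_le_delta[of j] \<delta>(2)[of j] by linarith
      qed (use \<delta>(1)[of j] y in auto)
      finally show ?thesis using \<delta>(1)[of j] by simp
    qed
  qed
  have M21: "exp s * \<bar>M$2$1\<bar> \<le> 5 * ?d"
  proof -
    have "exp s * \<bar>M$2$1\<bar> \<le> exp (t (Suc k)) * \<bar>first_col \<epsilon> (Suc k)$2\<bar>"
      unfolding col using s by (intro mult_right_mono) auto
    then show ?thesis using low[of "Suc k"] d' by linarith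
  qed
  have M12: "exp (- s) * \<bar>M$1$2\<bar> \<le> 6 * ?d"
  proof -
    define f where "f = limit_mat \<epsilon> *v axis 2 1"
    define v where "v = inv2 (block \<epsilon> 0 k) *v f"
    have f: "norm f \<le> 2"
    proof -
      have "\<bar>1 / first_col \<epsilon> 0$1\<bar> \<le> 2" using first_col_entry(1)[of \<epsilon> 0] by (simp add: divide_le_eq)
      moreover have "f$1 = 0" "f$2 = 1 / first_col \<epsilon> 0$1"
        by (simp_all add: f_def matrix_vector_2 limit_mat_def axis_def)
      ultimately show ?thesis using norm_vec2_le[of f] by simp
    qed
    have "norm v \<le> B k * 2"
      unfolding v_def
      by (rule order_trans[OF norm_matrix_vector mult_mono])
         (use block_norm[of \<epsilon> 0 k] f B[of k] in \<open>auto simp: entry_norm_inv2\<close>)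
    then have v: "\<bar>v$i\<bar> \<le> 2 * B k" for i using component_le_norm_cart[of v i] by linarith
    have "M$1$2 = (M *v axis 2 1)$1" by (simp add: matrix_vector_2 axis_def)
    also have "M *v axis 2 1 = inv2 (factor \<epsilon> k) *v v"
      by (simp add: M_def v_def f_def inv2_mult matrix_vector_mul_assoc matrix_mul_assoc)
    finally have M12: "M$1$2 = (inv2 (factor \<epsilon> k) *v v)$1" .
    have ts: "exp (- s) \<le> exp (- t k)" using s by simp
    have et: "exp (- t k) \<le> \<delta> k / B k"
    proof -
      have "B k / \<delta> k \<le> exp (t k)" using t[of k] exp_ge_add_one_self[of "t k"] by linarith
      moreover have "0 < B k / \<delta> k" using B[of k] d' by simp
      ultimately have "inverse (exp (t k)) \<le> inverse (B k / \<delta> k)" by (rule le_imp_inverse_le)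
      then show ?thesis by (simp add: exp_minus)
    qed
    have B0: "B k > 0" using B[of k] by linarith
    show ?thesis
    proof (cases "\<epsilon> k")
      case False
      then have "exp (- s) * \<bar>M$1$2\<bar> = exp (- s) * \<bar>v$1\<bar>" by (simp add: M12 factor_def inv2_one)
      also have "\<dots> \<le> (\<delta> k / B k) * (2 * B k)"
        using order_trans[OF ts et] v[of 1] B0 d' by (intro mult_mono) auto
      also have "\<dots> \<le> 6 * ?d" using B0 d' by simp
      finally show ?thesis .
    next
      case True
      have "M$1$2 = h k$2$2 * v$1 - h k$1$2 * v$2"
        unfolding M12 using True by (simp add: factor_def matrix_vector_2 inv2_def)
      then have "\<bar>M$1$2\<bar> \<le> \<bar>h k$2$2\<bar> * \<bar>v$1\<bar> + \<bar>h k$1$2\<bar> * \<bar>v$2\<bar>"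
        by (metis abs_mult abs_triangle_ineq4)
      then have "exp (- s) * \<bar>M$1$2\<bar> \<le> exp (- t k) * (\<bar>h k$2$2\<bar> * \<bar>v$1\<bar> + \<bar>h k$1$2\<bar> * \<bar>v$2\<bar>)"
        using ts by (intro mult_mono) auto
      also have "\<dots> = exp (- t k) * (\<bar>h k$2$2\<bar> * \<bar>v$1\<bar>) + (exp (- t k) * \<bar>h k$1$2\<bar>) * \<bar>v$2\<bar>"
        by (simp add: algebra_simps)
      also have "\<dots> \<le> (\<delta> k / B k) * ((3/2) * (2 * B k)) + (\<delta> k / B k) * (2 * B k)"
      proof (rule add_mono; rule mult_mono)
        have "\<bar>h k$2$2\<bar> \<le> 3/2" using h_entries(2)[of k] eta_le_delta[of k] \<delta>(2)[of k] by linarith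
        then show "\<bar>h k$2$2\<bar> * \<bar>v$1\<bar> \<le> (3/2) * (2 * B k)" using v[of 1] by (rule mult_mono) auto
        show "exp (- t k) * \<bar>h k$1$2\<bar> \<le> \<delta> k / B k" using h_entries(3)[of k] by simp
      qed (use B0 d' et v in auto)
      also have "\<dots> \<le> 6 * ?d" using B0 d' by simp
      finally show ?thesis .
    qed
  qed
  have M22: "\<bar>M$2$2 - 1\<bar> \<le> 30 * ?d"
  proof -
    have d: "M$1$1 * M$2$2 - M$1$2 * M$2$1 = 1" using detM by (simp add: det_2)
    have "\<bar>M$1$2 * M$2$1\<bar> = (exp (- s) * \<bar>M$1$2\<bar>) * (exp s * \<bar>M$2$1\<bar>)"
      by (simp add: abs_mult exp_minus)
    also have "\<dots> \<le> (6 * ?d) * (5 * ?d)" by (rule mult_mono[OF M12 M21]) (use d' in auto)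
    also have "\<dots> \<le> (6 * ?d) * (5 * (1/8))" using d' by (intro mult_left_mono) auto
    finally have p: "\<bar>M$1$2 * M$2$1\<bar> \<le> 4 * ?d" using d' by simp
    have "M$1$1 * (M$2$2 - 1) = (1 - M$1$1) + M$1$2 * M$2$1" using d by (simp add: algebra_simps)
    then have "\<bar>M$1$1 * (M$2$2 - 1)\<bar> \<le> 6 * ?d" using p M11 by linarith
    moreover have "1/2 * \<bar>M$2$2 - 1\<bar> \<le> \<bar>M$1$1 * (M$2$2 - 1)\<bar>"
      unfolding abs_mult using M11 d' by (intro mult_right_mono) auto
    ultimately have "1/2 * \<bar>M$2$2 - 1\<bar> \<le> 6 * ?d" by (rule order_trans[rotated])
    then show ?thesis using d' by simp
  qed
  have "dist (geo_conj s M) (mat 1) \<le>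
      \<bar>M$1$1 - 1\<bar> + exp (- s) * \<bar>M$1$2\<bar> + exp s * \<bar>M$2$1\<bar> + \<bar>M$2$2 - 1\<bar>"
    using dist_le_entries[of "geo_conj s M" "mat 1"]
    by (simp add: entry_norm_def geo_conj_def mat_def abs_mult)
  then show ?thesis using M11 M12 M21 M22 d' unfolding M_def by linarith
qed

lemma limit_mat_asymptotic:
  assumes "\<eta> > 0"
  shows "\<forall>\<^sub>F s in at_top. \<exists>A\<in>H. dist (geo_conj s (inv2 A ** limit_mat \<epsilon>)) (mat 1) < \<eta>"
proof -
  have pow: "\<delta> k \<le> 1 / 2 ^ k" for k
    using delta_decay[of 0 k] \<delta>(2)[of 0] by (simp add: divide_le_eq) (auto simp: field_simps)
  obtain K where "(1/2::real) ^ K < \<eta> / 50" using real_arch_pow_inv[of "\<eta> / 50" "1/2"] assms by auto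
  then have K: "50 * \<delta> k < \<eta>" if "K \<le> k" for k
  proof -
    have "(1/2::real) ^ k \<le> (1/2) ^ K" using that by (intro power_decreasing) auto
    moreover have "\<delta> k \<le> (1/2) ^ k" using pow[of k] by (simp add: power_one_over)
    ultimately show ?thesis using \<open>(1/2::real) ^ K < \<eta> / 50\<close> by linarith
  qed
  have "\<exists>A\<in>H. dist (geo_conj s (inv2 A ** limit_mat \<epsilon>)) (mat 1) < \<eta>" if s: "s \<ge> t K" for s
  proof -
    have big: "2 ^ k \<le> t k" for k
    proof -
      have "2 ^ k \<le> 1 / \<delta> k" using pow[of k] \<delta>(1)[of k] by (simp add: field_simps)
      also have "\<dots> \<le> B k / \<delta> k" using B[of k] \<delta>(1)[of k] by (intro divide_right_mono) auto
      finally show ?thesis using t[of k] by linarith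
    qed
    obtain m where m: "s < 2 ^ m" using real_arch_pow[of 2 s] by auto
    have "s < t (max m (Suc K))"
      using m big[of "max m (Suc K)"] power_increasing[of m "max m (Suc K)" "2::real"] by linarith
    then have "\<exists>n. n > K \<and> s < t n" by (intro exI[of _ "max m (Suc K)"]) auto
    then obtain n where n: "n > K" "s < t n" and least: "\<And>j. j < n \<Longrightarrow> \<not> (j > K \<and> s < t j)"
      using exists_least_iff[of "\<lambda>n. n > K \<and> s < t n"] by blast
    obtain k where k: "n = Suc k" "K \<le> k" using n by (cases n) auto
    have "t k \<le> s" using least[of k] k s by (cases "k = K") auto
    with limit_mat_close[of k s \<epsilon>] n k K[of k]
    show ?thesis by (intro bexI[OF _ block_H[of \<epsilon> 0 "Suc k"]]) (auto simp del: block.simps)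
  qed
  then show ?thesis unfolding eventually_at_top_linorder by blast
qed

end



section \<open>Discrete subgroups\<close>

text \<open>The preimage of \<open>\<Gamma>\<close> in \<open>SL(2,R)\<close>.\<close>

definition matrices :: "(real^2^2) set set \<Rightarrow> (real^2^2) set" where
  "matrices \<Gamma> = \<Union>\<Gamma>"

lemma matrices_coset:
  assumes "subgroup \<Gamma> PSL2R" "A \<in> matrices \<Gamma>"
  shows "det A = 1" "{A, - A} \<in> \<Gamma>"
proof -
  obtain X where X: "X \<in> \<Gamma>" "A \<in> X" using assms(2) unfolding matrices_def by blast
  then have "X \<in> carrier PSL2R" using subgroup.subset[OF assms(1)] by blast
  then obtain C where C: "X = {C, - C}" "det C = 1" unfolding carrier_PSL2R by blast
  have "det (- C) = det C" by (simp add: det_2)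
  then show "det A = 1" using X C by auto
  have "{A, - A} = X" using X C by auto
  then show "{A, - A} \<in> \<Gamma>" using X by simp
qed

lemma PSL2R_mult: "{A, - A} \<otimes>\<^bsub>PSL2R\<^esub> {B, - B} = {A ** B, - (A ** B)}"
  by (auto simp: PSL2R_def FactGroup_def set_mult_def mult_uminus)

lemma PSL2R_one: "\<one>\<^bsub>PSL2R\<^esub> = {mat 1, - mat 1}"
  by (simp add: PSL2R_def FactGroup_def)

lemma matrices_sl2_group:
  assumes "subgroup \<Gamma> PSL2R"
  shows "sl2_group (matrices \<Gamma>)"
proof
  show "det A = 1" if "A \<in> matrices \<Gamma>" for A using matrices_coset[OF assms that] by blast
  show "mat 1 \<in> matrices \<Gamma>" using subgroup.one_closed[OF assms] by (auto simp: PSL2R_one matrices_def)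
  show "A ** B \<in> matrices \<Gamma>" if "A \<in> matrices \<Gamma>" "B \<in> matrices \<Gamma>" for A B
    using subgroup.m_closed[OF assms matrices_coset(2)[OF assms that(1)] matrices_coset(2)[OF assms that(2)]]
    unfolding PSL2R_mult matrices_def by blast
  show "inv2 A \<in> matrices \<Gamma>" if "A \<in> matrices \<Gamma>" for A
  proof -
    note A = matrices_coset[OF assms that]
    have "inv\<^bsub>PSL2R\<^esub> {A, - A} = {inv2 A, - inv2 A}"
      by (rule group.inv_equality[OF group_PSL2R])
         (use inv2[OF A(1)] A(1) in \<open>auto simp: PSL2R_mult PSL2R_one carrier_PSL2R\<close>)
    then show ?thesis using subgroup.m_inv_closed[OF assms A(2)] by (auto simp: matrices_def)
  qed
qed

lemma matrices_uminus: "subgroup \<Gamma> PSL2R \<Longrightarrow> A \<in> matrices \<Gamma> \<Longrightarrow> - A \<in> matrices \<Gamma>"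
  using matrices_coset(2) unfolding matrices_def by blast

lemma discrete_isolated:
  assumes \<Gamma>: "discrete_subgroup \<Gamma>" and A: "A \<in> matrices \<Gamma>"
  shows "\<exists>e>0. \<forall>B\<in>matrices \<Gamma>. dist B A < e \<longrightarrow> B = A \<or> B = - A"
proof -
  have sub: "subgroup \<Gamma> PSL2R" and top: "subtopology PSL2R_topology \<Gamma> = discrete_topology \<Gamma>"
    using \<Gamma> by (auto simp: discrete_subgroup_def)
  have "openin (subtopology PSL2R_topology \<Gamma>) {{A, - A}}"
    unfolding top using matrices_coset(2)[OF sub A] by simp
  then obtain U where U: "openin PSL2R_topology U" "{{A, - A}} = U \<inter> \<Gamma>"
    unfolding openin_subtopology by blast
  let ?P = "{B \<in> carrier SL2R. {mat 1, - mat 1} #>\<^bsub>SL2R\<^esub> B \<in> U}"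
  have "openin (top_of_set (carrier SL2R)) ?P" using U(1) unfolding openin_PSL2R_topology by blast
  moreover have "A \<in> ?P" using matrices_coset(1)[OF sub A] U(2) by (auto simp: PSL2R_coset)
  ultimately obtain e where e: "e > 0" "ball A e \<inter> carrier SL2R \<subseteq> ?P"
    unfolding openin_contains_ball by blast
  have "B = A \<or> B = - A" if B: "B \<in> matrices \<Gamma>" "dist B A < e" for B
  proof -
    have "B \<in> ?P" using e(2) B(2) matrices_coset(1)[OF sub B(1)] by (auto simp: dist_commute)
    then have "{B, - B} \<in> U \<inter> \<Gamma>" using matrices_coset(2)[OF sub B(1)] by (simp add: PSL2R_coset)
    then have "{B, - B} = {A, - A}" unfolding U(2)[symmetric] by simp
    then have "B \<in> {A, - A}" by (metis insertI1)
    then show ?thesis by simp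
  qed
  then show ?thesis using e(1) by blast
qed

text \<open>A subset of a second countable space is countable if each of its points has a neighbourhood that meets
  it in a finite set.\<close>

lemma discrete_countable:
  assumes "discrete_subgroup \<Gamma>"
  shows "countable (matrices \<Gamma>)"
proof -
  let ?L = "matrices \<Gamma>"
  have "\<forall>A\<in>?L. \<exists>e>0. \<forall>B\<in>?L. dist B A < e \<longrightarrow> B = A \<or> B = - A"
    using discrete_isolated[OF assms] by blast
  then obtain e where e: "\<And>A. A \<in> ?L \<Longrightarrow> e A > 0"
    "\<And>A B. A \<in> ?L \<Longrightarrow> B \<in> ?L \<Longrightarrow> dist B A < e A \<Longrightarrow> B = A \<or> B = - A"
    by metis
  define F where "F = (\<lambda>A. ball A (e A)) ` ?L"
  obtain F' where F': "F' \<subseteq> F" "countable F'" "\<Union>F' = \<Union>F"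
    using Lindelof[of F] by (auto simp: F_def)
  have cov: "?L \<subseteq> (\<Union>V\<in>F'. V \<inter> ?L)"
  proof
    fix A assume A: "A \<in> ?L"
    then have "A \<in> ball A (e A)" using e(1) by simp
    then have "A \<in> \<Union>F" using A unfolding F_def by blast
    then show "A \<in> (\<Union>V\<in>F'. V \<inter> ?L)" using A F'(3) by blast
  qed
  have "countable (V \<inter> ?L)" if V: "V \<in> F'" for V
  proof -
    obtain A where "A \<in> ?L" "V = ball A (e A)" using F' V unfolding F_def by blast
    then have "B = A \<or> B = - A" if "B \<in> V \<inter> ?L" for B
      using e(2)[of A B] that by (simp add: dist_commute)
    then have "V \<inter> ?L \<subseteq> {A, - A}" by blast
    then show ?thesis by (rule countable_subset) simp
  qed
  then have "countable (\<Union>V\<in>F'. V \<inter> ?L)" using F'(2) by blast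
  with cov show ?thesis by (rule countable_subset)
qed

section \<open>The flows as right multiplications\<close>

definition geo_mat :: "real \<Rightarrow> real^2^2" where "geo_mat t = M2 (exp (t/2)) 0 0 (exp (- (t/2)))"
definition horo_mat :: "real \<Rightarrow> real^2^2" where "horo_mat s = M2 1 s 0 1"

lemma det_geo_mat: "det (geo_mat t) = 1" by (simp add: geo_mat_def det_2 flip: exp_add)
lemma det_horo_mat: "det (horo_mat s) = 1" by (simp add: horo_mat_def det_2)

lemma geo_mat_add: "geo_mat s ** geo_mat t = geo_mat (s + t)"
  by (rule matrix2_eqI) (simp_all add: matrix_mult_2 geo_mat_def add_divide_distrib flip: exp_add)

lemma inv2_geo_mat: "inv2 (geo_mat t) = geo_mat (- t)"
  by (simp add: inv2_def geo_mat_def)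

text \<open>The geodesic flow contracts horocycles centered at the forward endpoint.\<close>

lemma horo_geo_mat: "horo_mat s ** geo_mat t = geo_mat t ** horo_mat (s * exp (- t))"
proof -
  have "exp (- (t/2)) = exp (t/2) * exp (- t)" by (simp flip: exp_add)
  then show ?thesis by (intro matrix2_eqI) (simp_all add: matrix_mult_2 geo_mat_def horo_mat_def)
qed

lemma horo_mat_add: "horo_mat r ** horo_mat s = horo_mat (r + s)"
  by (rule matrix2_eqI) (simp_all add: matrix_mult_2 horo_mat_def)

lemma geo_conj_eq: "geo_conj t A = geo_mat (- t) ** A ** geo_mat t"
proof -
  have "exp (t/2) * exp (t/2) = exp t" "exp (- (t/2)) * exp (- (t/2)) = exp (- t)"
    by (simp_all flip: exp_add)
  then show ?thesis
    by (intro matrix2_eqI) (simp_all add: matrix_mult_2 geo_mat_def geo_conj_def mult_ac exp_minus)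
qed

abbreviation base_vec :: "complex \<times> complex" where "base_vec \<equiv> (\<i>, \<i>)"

lemma base_vec_T1H2: "base_vec \<in> T1H2" by (simp add: T1H2_iff)

lemma act_base_T1H2: "det A = 1 \<Longrightarrow> SL2R_act A base_vec \<in> T1H2"
  by (rule SL2R_act_T1H2[OF _ base_vec_T1H2])

lemma act_base_mult: "det A = 1 \<Longrightarrow> det B = 1 \<Longrightarrow> SL2R_act (A ** B) base_vec = SL2R_act A (SL2R_act B base_vec)"
  by (simp add: SL2R_act_mult)

lemma geo_mat_base: "SL2R_act (geo_mat t) base_vec = (\<i> * of_real (exp t), \<i> * of_real (exp t))"
proof -
  have e: "exp (t/2) * exp (t/2) = exp t" by (simp flip: exp_add)
  have "of_real (exp (t/2)) * of_real (exp (t/2)) = (of_real (exp t) :: complex)"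
    unfolding of_real_mult[symmetric] e ..
  then show ?thesis
    by (simp add: SL2R_act_def geo_mat_def exp_minus field_simps power2_eq_square)
qed

lemma geodesic_flow_mat: "det A = 1 \<Longrightarrow> geodesic_flow t (SL2R_act A base_vec) = SL2R_act (A ** geo_mat t) base_vec"
  by (simp add: act_base_mult det_geo_mat geo_mat_base geodesic_flow_eq)

lemma horocyclic_flow_mat: "det A = 1 \<Longrightarrow> horocyclic_flow s (SL2R_act A base_vec) = SL2R_act (A ** horo_mat s) base_vec"
  by (simp add: act_base_mult det_horo_mat horocyclic_flow_eq) (simp add: SL2R_act_def horo_mat_def)

lemma stabilizer_base:
  assumes A: "det A = 1" and B: "det B = 1" and eq: "SL2R_act A base_vec = SL2R_act B base_vec"
  shows "B = A \<or> B = - A"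
proof -
  define C where "C = inv2 A ** B"
  have dC: "det C = 1" using inv2(1)[OF A] B by (simp add: C_def det_mul)
  have "SL2R_act C base_vec = SL2R_act (inv2 A) (SL2R_act A base_vec)"
    using act_base_mult[OF inv2(1)[OF A] B] eq by (simp add: C_def)
  also have "\<dots> = base_vec" by (rule act_inv2(2)[OF A]) simp
  finally have C: "SL2R_act C base_vec = base_vec" .
  let ?d = "of_real (C$2$1) * \<i> + of_real (C$2$2) :: complex"
  have d: "?d \<noteq> 0" using denom_nz[OF dC, of \<i>] by simp
  have "\<i> / ?d\<^sup>2 = \<i>" and n: "(of_real (C$1$1) * \<i> + of_real (C$1$2)) / ?d = \<i>"
    using C by (simp_all add: SL2R_act_def)
  then have "?d\<^sup>2 = 1" using d by (simp add: divide_eq_eq)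
  then have d1: "?d = 1 \<or> ?d = - 1" by (simp add: power2_eq_1_iff)
  have n: "of_real (C$1$1) * \<i> + of_real (C$1$2) = \<i> * ?d" using n d by (simp add: divide_eq_eq)
  have "C = mat 1 \<or> C = - mat 1"
    using d1
  proof
    assume "?d = 1"
    with n have "C = mat 1" by (intro matrix2_eqI) (auto simp: complex_eq_iff mat_def)
    then show ?thesis ..
  next
    assume "?d = - 1"
    with n have "C = - mat 1" by (intro matrix2_eqI) (auto simp: complex_eq_iff mat_def)
    then show ?thesis ..
  qed
  moreover have "B = A ** C" using inv2(3)[OF A] by (simp add: C_def matrix_mul_assoc)
  ultimately show ?thesis by (auto simp: mult_uminus)
qed

text \<open>The point of \<open>T1S \<Gamma>\<close> that corresponds to the coset of \<open>A\<close> in the quotient of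
  \<open>SL(2,R)\<close> by \<open>\<Gamma>\<close> on the left.\<close>

definition vec_orbit :: "(real^2^2) set set \<Rightarrow> real^2^2 \<Rightarrow> (complex \<times> complex) set" where
  "vec_orbit \<Gamma> A = (\<lambda>B. SL2R_act (B ** A) base_vec) ` matrices \<Gamma>"

context
  fixes \<Gamma> :: "(real^2^2) set set"
  assumes sub: "subgroup \<Gamma> PSL2R"
begin

interpretation lift: sl2_group "matrices \<Gamma>" by (rule matrices_sl2_group[OF sub])

lemma T1S_vec_orbit: "T1S \<Gamma> = vec_orbit \<Gamma> ` {A. det A = 1}"
proof -
  have "(\<lambda>X. PSL2R_act X v) ` \<Gamma> = (\<lambda>B. SL2R_act B v) ` matrices \<Gamma>" for v
  proof -
    have 1: "PSL2R_act X v = SL2R_act B v" if "X \<in> \<Gamma>" "B \<in> X" for X B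
    proof -
      have "X \<in> carrier PSL2R" using subgroup.subset[OF sub] that by blast
      then obtain C where C: "X = {C, - C}" unfolding carrier_PSL2R by blast
      then show ?thesis using that(2) by (auto simp: PSL2R_act_coset SL2R_act_uminus)
    qed
    have "X \<noteq> {}" if "X \<in> \<Gamma>" for X
      using subgroup.subset[OF sub] that unfolding carrier_PSL2R by blast
    then have "\<exists>B\<in>X. PSL2R_act X v = SL2R_act B v" if "X \<in> \<Gamma>" for X using 1 that by blast
    then have 2: "PSL2R_act X v \<in> (\<lambda>B. SL2R_act B v) ` matrices \<Gamma>" if "X \<in> \<Gamma>" for X
      using that unfolding matrices_def by (metis UnionI image_eqI)
    have 3: "SL2R_act B v \<in> (\<lambda>X. PSL2R_act X v) ` \<Gamma>" if "B \<in> matrices \<Gamma>" for B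
      using that 1 unfolding matrices_def by (metis UnionE image_eqI)
    show ?thesis by (intro equalityI image_subsetI 2 3)
  qed
  then have T: "T1S \<Gamma> = (\<lambda>v. (\<lambda>B. SL2R_act B v) ` matrices \<Gamma>) ` T1H2" by (simp add: T1S_def)
  have o: "vec_orbit \<Gamma> A = (\<lambda>B. SL2R_act B (SL2R_act A base_vec)) ` matrices \<Gamma>" if "det A = 1" for A
    unfolding vec_orbit_def using that lift.det by (intro image_cong) (auto simp: act_base_mult)
  have TH: "T1H2 = (\<lambda>A. SL2R_act A base_vec) ` {A. det A = 1}"
  proof (intro equalityI subsetI)
    fix v assume "v \<in> T1H2"
    then show "v \<in> (\<lambda>A. SL2R_act A base_vec) ` {A. det A = 1}" by (rule SL2R_transitive) blast
  qed (auto intro: act_base_T1H2)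
  have "T1S \<Gamma> = (\<lambda>A. (\<lambda>B. SL2R_act B (SL2R_act A base_vec)) ` matrices \<Gamma>) ` {A. det A = 1}"
    unfolding T unfolding TH image_image ..
  also have "\<dots> = vec_orbit \<Gamma> ` {A. det A = 1}" by (intro image_cong) (auto simp: o)
  finally show ?thesis .
qed

lemma vec_orbit_T1S: "det A = 1 \<Longrightarrow> vec_orbit \<Gamma> A \<in> T1S \<Gamma>"
  by (simp add: T1S_vec_orbit)

lemma vec_orbit_T1H2: "det A = 1 \<Longrightarrow> vec_orbit \<Gamma> A \<subseteq> T1H2"
  unfolding vec_orbit_def using lift.det by (auto simp: det_mul intro!: act_base_T1H2)

lemma vec_orbit_self: "SL2R_act A base_vec \<in> vec_orbit \<Gamma> A"
  unfolding vec_orbit_def by (rule image_eqI[of _ _ "mat 1"]) (use lift.one in auto)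

lemma vec_orbit_nonempty: "vec_orbit \<Gamma> A \<noteq> {}"
  using vec_orbit_self by blast

lemma geo_vec_orbit: "det A = 1 \<Longrightarrow> geo t (vec_orbit \<Gamma> A) = vec_orbit \<Gamma> (A ** geo_mat t)"
  unfolding geo_def vec_orbit_def image_image
  using lift.det by (intro image_cong) (auto simp: geodesic_flow_mat det_mul matrix_mul_assoc)

lemma horo_vec_orbit: "det A = 1 \<Longrightarrow> horo s (vec_orbit \<Gamma> A) = vec_orbit \<Gamma> (A ** horo_mat s)"
  unfolding horo_def vec_orbit_def image_image
  using lift.det by (intro image_cong) (auto simp: horocyclic_flow_mat det_mul matrix_mul_assoc)

lemma in_vec_orbit:
  assumes "det A = 1" "det B = 1" "SL2R_act B base_vec \<in> vec_orbit \<Gamma> A"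
  obtains C where "C \<in> matrices \<Gamma>" "B = C ** A"
proof -
  obtain C where C: "C \<in> matrices \<Gamma>" "SL2R_act (C ** A) base_vec = SL2R_act B base_vec"
    using assms(3) unfolding vec_orbit_def by force
  have "det (C ** A) = 1" using lift.det[OF C(1)] assms(1) by (simp add: det_mul)
  from stabilizer_base[OF this assms(2) C(2)] have "B = C ** A \<or> B = (- C) ** A"
    by (simp add: mult_uminus)
  then show ?thesis using that C(1) matrices_uminus[OF sub C(1)] by blast
qed

lemma horocyclic_orbit_vec_orbit:
  "det A = 1 \<Longrightarrow> horocyclic_orbit (vec_orbit \<Gamma> A) = range (\<lambda>s. vec_orbit \<Gamma> (A ** horo_mat s))"
  by (simp add: horocyclic_orbit_def horo_vec_orbit)

lemma horo_mat_0: "horo_mat 0 = mat 1"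
  by (rule matrix2_eqI) (simp_all add: horo_mat_def mat_def)

lemma horocyclic_orbit_self: "v \<in> T1S \<Gamma> \<Longrightarrow> v \<in> horocyclic_orbit v"
  unfolding T1S_vec_orbit using horo_mat_0
  by (auto simp: horocyclic_orbit_vec_orbit intro!: image_eqI[of _ _ 0])

lemma horocyclic_orbit_eq:
  assumes "v \<in> T1S \<Gamma>" "w \<in> horocyclic_orbit v"
  shows "horocyclic_orbit w = horocyclic_orbit v"
proof -
  obtain A where A: "det A = 1" "v = vec_orbit \<Gamma> A" using assms(1) unfolding T1S_vec_orbit by blast
  obtain s where s: "w = vec_orbit \<Gamma> (A ** horo_mat s)"
    using assms(2) A by (auto simp: horocyclic_orbit_vec_orbit)
  have "det (A ** horo_mat s) = 1" using A by (simp add: det_mul det_horo_mat)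
  then have "horocyclic_orbit w = range (\<lambda>r. vec_orbit \<Gamma> (A ** horo_mat (s + r)))"
    by (simp add: s horocyclic_orbit_vec_orbit horo_mat_add flip: matrix_mul_assoc)
  also have "\<dots> = (\<lambda>r. vec_orbit \<Gamma> (A ** horo_mat r)) ` range ((+) s)" by (simp only: image_image)
  also have "range ((+) s) = UNIV" by (rule surj_plus)
  finally show ?thesis using A by (simp add: horocyclic_orbit_vec_orbit)
qed

section \<open>Strong stable sets\<close>

lemma strong_stable_horo:
  assumes u: "u \<in> T1S \<Gamma>" and v: "v \<in> strong_stable_set \<Gamma> u"
  shows "horo s v \<in> strong_stable_set \<Gamma> u"
proof -
  obtain g where g: "det g = 1" "u = vec_orbit \<Gamma> g" using u unfolding T1S_vec_orbit by blast
  have lim: "((\<lambda>t. sasaki_dist (geo t u) (geo t v)) \<longlongrightarrow> 0) at_top" and "v \<in> T1S \<Gamma>"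
    using v by (auto simp: strong_stable_set_def)
  then obtain A where A: "det A = 1" "v = vec_orbit \<Gamma> A" unfolding T1S_vec_orbit by blast
  let ?n = "\<lambda>t. horo_mat (s * exp (- t))"
  have dets: "det (g ** geo_mat t) = 1" "det (A ** geo_mat t) = 1" "det (A ** horo_mat s) = 1" for t
    using g A by (simp_all add: det_mul det_geo_mat det_horo_mat)
  have hs: "horo s v = vec_orbit \<Gamma> (A ** horo_mat s)" using A by (simp add: horo_vec_orbit)
  have ghs: "geo t (horo s v) = vec_orbit \<Gamma> (A ** geo_mat t ** ?n t)" for t
    unfolding hs geo_vec_orbit[OF dets(3)]
    by (simp only: horo_geo_mat matrix_mul_assoc[symmetric])
  have upper: "sasaki_dist (geo t u) (geo t (horo s v))
      \<le> sasaki_dist (geo t u) (geo t v) + displacement (SL2R_act (?n t) base_vec)" for t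
  proof (rule sasaki_dist_step)
    show "geo t u \<subseteq> T1H2" "geo t v \<subseteq> T1H2" "geo t u \<noteq> {}" "geo t v \<noteq> {}"
      using g A dets by (simp_all add: geo_vec_orbit vec_orbit_T1H2 vec_orbit_nonempty)
    show "det (?n t) = 1" by (rule det_horo_mat)
    fix B assume B: "det B = 1" "SL2R_act B base_vec \<in> geo t v"
    then have "SL2R_act B base_vec \<in> vec_orbit \<Gamma> (A ** geo_mat t)" using A by (simp add: geo_vec_orbit)
    from in_vec_orbit[OF dets(2) B(1) this] obtain C where C: "C \<in> matrices \<Gamma>" "B = C ** (A ** geo_mat t)" .
    show "SL2R_act (B ** ?n t) base_vec \<in> geo t (horo s v)"
      unfolding ghs vec_orbit_def C(2) using C(1) by (intro image_eqI[of _ _ C]) (simp_all add: matrix_mul_assoc)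
  qed
  have lower: "0 \<le> sasaki_dist (geo t u) (geo t (horo s v))" for t
    using g hs dets
    by (intro sasaki_dist_nonneg) (simp_all add: geo_vec_orbit vec_orbit_T1H2 vec_orbit_nonempty det_mul det_geo_mat det_horo_mat)
  have "((\<lambda>t. displacement (SL2R_act (?n t) base_vec)) \<longlongrightarrow> 0) at_top"
  proof (rule tendstoI)
    fix \<epsilon> :: real assume "\<epsilon> > 0"
    then obtain \<delta> where \<delta>: "\<delta> > 0" "\<And>k::real^2^2. dist k (mat 1) < \<delta> \<Longrightarrow> displacement (SL2R_act k base_vec) < \<epsilon>"
      using displacement_small by blast
    have "((\<lambda>t. s * exp (- t)) \<longlongrightarrow> s * 0) at_top"
      by (intro tendsto_mult tendsto_const filterlim_compose[OF exp_at_bot filterlim_uminus_at_bot_at_top])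
    then have "\<forall>\<^sub>F t in at_top. \<bar>s * exp (- t)\<bar> < \<delta>"
      using tendstoD[OF _ \<delta>(1)] by (fastforce simp: dist_real_def)
    then show "\<forall>\<^sub>F t in at_top. dist (displacement (SL2R_act (?n t) base_vec)) 0 < \<epsilon>"
    proof (rule eventually_mono)
      fix t assume "\<bar>s * exp (- t)\<bar> < \<delta>"
      moreover have "dist (?n t) (mat 1) \<le> \<bar>s * exp (- t)\<bar>"
        using dist_le_entries[of "?n t" "mat 1"] by (simp add: entry_norm_def horo_mat_def mat_def)
      ultimately have "displacement (SL2R_act (?n t) base_vec) < \<epsilon>" by (intro \<delta>(2)) simp
      moreover have "0 \<le> displacement (SL2R_act (?n t) base_vec)"
        using act_base_T1H2[OF det_horo_mat, of "s * exp (- t)"] by (simp add: displacement_def T1H2_iff)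
      ultimately show "dist (displacement (SL2R_act (?n t) base_vec)) 0 < \<epsilon>" by simp
    qed
  qed
  from tendsto_add[OF lim this]
  have "((\<lambda>t. sasaki_dist (geo t u) (geo t v) + displacement (SL2R_act (?n t) base_vec)) \<longlongrightarrow> 0) at_top" by simp
  then have "((\<lambda>t. sasaki_dist (geo t u) (geo t (horo s v))) \<longlongrightarrow> 0) at_top"
    by (rule tendsto_sandwich[OF _ _ tendsto_const, rotated 2]) (simp_all add: upper lower)
  then show ?thesis using hs dets(3) by (simp add: strong_stable_set_def vec_orbit_T1S)
qed

text \<open>The elements of \<open>\<Gamma>\<close> that bring the two geodesics together may depend on the time; this is what
  lets the strong stable set be larger than a horocyclic orbit.\<close>

lemma strong_stable_member:
  assumes g: "det g = 1" and w: "det w = 1"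
    and close: "\<And>\<eta>. \<eta> > 0 \<Longrightarrow> \<forall>\<^sub>F t in at_top. \<exists>B\<in>matrices \<Gamma>.
      dist (geo_conj t (inv2 (inv2 g ** B ** g) ** w)) (mat 1) < \<eta>"
  shows "vec_orbit \<Gamma> (g ** w) \<in> strong_stable_set \<Gamma> (vec_orbit \<Gamma> g)"
proof -
  have gw: "det (g ** w) = 1" using g w by (simp add: det_mul)
  let ?u = "vec_orbit \<Gamma> g" and ?v = "vec_orbit \<Gamma> (g ** w)"
  have lower: "0 \<le> sasaki_dist (geo t ?u) (geo t ?v)" for t
    using g gw by (intro sasaki_dist_nonneg)
      (simp_all add: geo_vec_orbit vec_orbit_T1H2 vec_orbit_nonempty det_mul det_geo_mat)
  have "((\<lambda>t. sasaki_dist (geo t ?u) (geo t ?v)) \<longlongrightarrow> 0) at_top"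
  proof (rule tendstoI)
    fix \<epsilon> :: real assume "\<epsilon> > 0"
    then obtain \<delta> where \<delta>: "\<delta> > 0" "\<And>k::real^2^2. dist k (mat 1) < \<delta> \<Longrightarrow> displacement (SL2R_act k base_vec) < \<epsilon>"
      using displacement_small by blast
    from close[OF \<delta>(1)] show "\<forall>\<^sub>F t in at_top. dist (sasaki_dist (geo t ?u) (geo t ?v)) 0 < \<epsilon>"
    proof (rule eventually_mono)
      fix t assume "\<exists>B\<in>matrices \<Gamma>. dist (geo_conj t (inv2 (inv2 g ** B ** g) ** w)) (mat 1) < \<delta>"
      then obtain B where B: "B \<in> matrices \<Gamma>" and
        near: "dist (geo_conj t (inv2 (inv2 g ** B ** g) ** w)) (mat 1) < \<delta>" by blast
      let ?h = "inv2 g ** B ** g"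
      define k where "k = geo_conj t (inv2 ?h ** w)"
      have dB: "det B = 1" using lift.det B .
      have dh: "det ?h = 1" using dB g inv2(1)[OF g] by (simp add: det_mul)
      have dk: "det k = 1"
        using w inv2(1)[OF dh] by (simp add: k_def geo_conj_eq det_mul det_geo_mat)
      have "B ** (g ** geo_mat t) ** k = B ** g ** (geo_mat t ** geo_mat (- t)) ** inv2 ?h ** w ** geo_mat t"
        by (simp add: k_def geo_conj_eq matrix_mul_assoc)
      also have "geo_mat t ** geo_mat (- t) = mat 1"
        by (simp add: geo_mat_add) (rule matrix2_eqI, simp_all add: geo_mat_def mat_def)
      also have "B ** g ** mat 1 ** inv2 ?h ** w ** geo_mat t = ((g ** inv2 g) ** B ** g) ** inv2 ?h ** w ** geo_mat t"
        using inv2(3)[OF g] by simp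
      also have "\<dots> = g ** (?h ** inv2 ?h) ** w ** geo_mat t" by (simp only: matrix_mul_assoc)
      also have "\<dots> = g ** w ** geo_mat t" using inv2(3)[OF dh] by simp
      finally have Bk: "B ** (g ** geo_mat t) ** k = g ** w ** geo_mat t" .
      have "sasaki_dist (geo t ?u) (geo t ?v) \<le> displacement (SL2R_act k base_vec)"
      proof (rule sasaki_dist_le_displacement)
        show "det (B ** (g ** geo_mat t)) = 1" using dB g by (simp add: det_mul det_geo_mat)
        show "SL2R_act (B ** (g ** geo_mat t)) base_vec \<in> geo t ?u"
          unfolding geo_vec_orbit[OF g] unfolding vec_orbit_def using B by blast
        show "SL2R_act (B ** (g ** geo_mat t) ** k) base_vec \<in> geo t ?v"
          unfolding geo_vec_orbit[OF gw] Bk by (rule vec_orbit_self)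
      qed (rule dk)
      also have "\<dots> < \<epsilon>" using near by (intro \<delta>(2)) (simp add: k_def)
      finally show "dist (sasaki_dist (geo t ?u) (geo t ?v)) 0 < \<epsilon>" using lower[of t] by simp
    qed
  qed
  then show ?thesis using vec_orbit_T1S[OF gw] by (simp add: strong_stable_set_def)
qed

section \<open>Short closed geodesics crossing a ray\<close>

lemma conjugate_group:
  assumes g: "det g = 1"
  shows "sl2_group ((\<lambda>B. inv2 g ** B ** g) ` matrices \<Gamma>)"
proof
  note i = inv2[OF g]
  show "det A = 1" if "A \<in> (\<lambda>B. inv2 g ** B ** g) ` matrices \<Gamma>" for A
    using that lift.det i(1) g by (auto simp: det_mul)
  show "mat 1 \<in> (\<lambda>B. inv2 g ** B ** g) ` matrices \<Gamma>"
    using lift.one i by (intro image_eqI[of _ _ "mat 1"]) auto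
  show "A ** B \<in> (\<lambda>B. inv2 g ** B ** g) ` matrices \<Gamma>"
    if AB: "A \<in> (\<lambda>B. inv2 g ** B ** g) ` matrices \<Gamma>" "B \<in> (\<lambda>B. inv2 g ** B ** g) ` matrices \<Gamma>" for A B
  proof -
    obtain C D where CD: "C \<in> matrices \<Gamma>" "D \<in> matrices \<Gamma>" "A = inv2 g ** C ** g" "B = inv2 g ** D ** g" using AB by blast
    have "A ** B = inv2 g ** C ** (g ** inv2 g) ** D ** g" by (simp only: CD matrix_mul_assoc)
    then have "A ** B = inv2 g ** (C ** D) ** g" using i by (simp add: matrix_mul_assoc)
    then show ?thesis using lift.mult[OF CD(1,2)] by blast
  qed
  have "inv2 (inv2 g) = g" by (rule matrix2_eqI) (simp_all add: inv2_def)
  then show "inv2 A \<in> (\<lambda>B. inv2 g ** B ** g) ` matrices \<Gamma>" if "A \<in> (\<lambda>B. inv2 g ** B ** g) ` matrices \<Gamma>" for A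
    using that lift.inv by (auto simp: inv2_mult matrix_mul_assoc)
qed

text \<open>
  The hyperbolic element whose axis is a lift of the closed geodesic through the point \<open>g(\<i> exp t)\<close> becomes, in
  the frame at that point, the translation by \<open>l\<close> along a geodesic through \<open>\<i>\<close>, that is, a
  conjugate of \<open>geo_mat l\<close> by a rotation. It is close to 1 if \<open>l\<close> is small. It cannot fix \<open>e1\<close>,
  as its trace exceeds 2.
\<close>

lemma short_geodesic_crossing:
  assumes g: "det g = 1" and C: "closed_geodesic \<Gamma> C l" and meets: "geodesic_ray (vec_orbit \<Gamma> g) \<inter> C \<noteq> {}"
  shows "\<exists>t\<ge>0. \<exists>B\<in>matrices \<Gamma>. entry_norm (geo_conj t (inv2 g ** B ** g) - mat 1) \<le> 4 * (exp (l/2) - exp (- (l/2)))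
     \<and> (inv2 g ** B ** g) *v e1 \<noteq> e1"
proof -
  obtain v where l: "l > 0" and v: "v \<in> T1S \<Gamma>" "geo l v = v" "C = range (\<lambda>t. base_point (geo t v))"
    using C unfolding closed_geodesic_def by blast
  obtain b where b: "det b = 1" "v = vec_orbit \<Gamma> b" using v(1) unfolding T1S_vec_orbit by blast
  obtain t \<tau> where t: "t \<ge> 0" and meet: "base_point (geo t (vec_orbit \<Gamma> g)) = base_point (geo \<tau> v)"
    using meets v(3) unfolding geodesic_ray_def by auto
  define p where "p = g ** geo_mat t"
  have dp: "det p = 1" using g by (simp add: p_def det_mul det_geo_mat)
  have "fst (SL2R_act p base_vec) \<in> base_point (geo t (vec_orbit \<Gamma> g))"
    unfolding base_point_def geo_vec_orbit[OF g] p_def using vec_orbit_self by blast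
  then have "fst (SL2R_act p base_vec) \<in> fst ` vec_orbit \<Gamma> (b ** geo_mat \<tau>)"
    unfolding meet unfolding base_point_def b(2) geo_vec_orbit[OF b(1)] .
  then obtain D where D: "D \<in> matrices \<Gamma>" "fst (SL2R_act p base_vec) = fst (SL2R_act (D ** (b ** geo_mat \<tau>)) base_vec)"
    unfolding vec_orbit_def by blast
  define q where "q = D ** (b ** geo_mat \<tau>)"
  have dD: "det D = 1" using lift.det D(1) .
  have dq: "det q = 1" using dD b by (simp add: q_def det_mul det_geo_mat)
  \<comment> \<open>Both vectors have the same base point, so they differ by a rotation.\<close>
  define \<rho> where "\<rho> = inv2 p ** q"
  have d\<rho>: "det \<rho> = 1" using inv2(1)[OF dp] dq by (simp add: \<rho>_def det_mul)
  have "fst (SL2R_act \<rho> base_vec) = fst (SL2R_act (inv2 p) (SL2R_act q base_vec))"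
    using act_base_mult[OF inv2(1)[OF dp] dq] by (simp add: \<rho>_def)
  also have "\<dots> = fst (SL2R_act (inv2 p) (SL2R_act p base_vec))"
    using D(2) by (simp add: q_def[symmetric] SL2R_act_def)
  also have "\<dots> = \<i>" using act_inv2(2)[OF dp, of base_vec] by simp
  finally have fixed: "fst (SL2R_act \<rho> base_vec) = \<i>" .
  have "of_real (\<rho>$2$1) * \<i> + of_real (\<rho>$2$2) \<noteq> (0::complex)" using denom_nz[OF d\<rho>, of \<i>] by simp
  with fixed have "of_real (\<rho>$1$1) * \<i> + of_real (\<rho>$1$2) = \<i> * (of_real (\<rho>$2$1) * \<i> + of_real (\<rho>$2$2))"
    by (simp add: SL2R_act_def divide_eq_eq)
  then have rot: "\<rho>$2$2 = \<rho>$1$1" "\<rho>$2$1 = - \<rho>$1$2" by (simp_all add: complex_eq_iff)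
  define x y where "x = \<rho>$1$1" and "y = \<rho>$1$2"
  have xy: "x * x + y * y = 1" using d\<rho> rot by (simp add: det_2 x_def y_def)
  \<comment> \<open>Closing up after time \<open>l\<close> provides an element of the group that translates along the axis by \<open>l\<close>.\<close>
  have "vec_orbit \<Gamma> (b ** geo_mat l) = vec_orbit \<Gamma> b" using v(2) b by (simp add: geo_vec_orbit)
  then have "SL2R_act (b ** geo_mat l) base_vec \<in> vec_orbit \<Gamma> b" using vec_orbit_self by blast
  then obtain F where F: "F \<in> matrices \<Gamma>" "b ** geo_mat l = F ** b"
    by (rule in_vec_orbit[OF b(1), rotated]) (use b in \<open>simp_all add: det_mul det_geo_mat\<close>)
  define E where "E = D ** F ** inv2 D"
  have E: "E \<in> matrices \<Gamma>" unfolding E_def using D(1) F(1) lift.mult lift.inv by blast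
  have "E ** q = D ** F ** (inv2 D ** D) ** b ** geo_mat \<tau>" by (simp only: E_def q_def matrix_mul_assoc)
  also have "\<dots> = D ** (F ** b) ** geo_mat \<tau>" using inv2(2)[OF dD] by (simp add: matrix_mul_assoc)
  also have "\<dots> = D ** b ** (geo_mat l ** geo_mat \<tau>)" by (simp only: F(2)[symmetric] matrix_mul_assoc)
  also have "geo_mat l ** geo_mat \<tau> = geo_mat \<tau> ** geo_mat l" by (simp add: geo_mat_add add.commute)
  finally have Eq: "E ** q = q ** geo_mat l" by (simp add: q_def matrix_mul_assoc)
  let ?h = "inv2 g ** E ** g"
  define k where "k = geo_conj t ?h"
  have ip: "inv2 p = geo_mat (- t) ** inv2 g" by (simp add: p_def inv2_mult inv2_geo_mat)
  have "k = inv2 p ** E ** p"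
    unfolding k_def geo_conj_eq ip unfolding p_def by (simp only: matrix_mul_assoc)
  moreover have "\<rho> ** inv2 \<rho> = mat 1" using inv2(3)[OF d\<rho>] .
  moreover have "p ** \<rho> = q" using inv2(3)[OF dp] by (simp add: \<rho>_def matrix_mul_assoc)
  ultimately have "k = inv2 p ** (E ** q) ** inv2 \<rho>" by (metis matrix_mul_assoc matrix_mul_rid)
  then have k: "k = \<rho> ** geo_mat l ** inv2 \<rho>" unfolding Eq by (simp add: \<rho>_def matrix_mul_assoc)
  define a d where "a = exp (l/2)" and "d = exp (- (l/2))"
  have ad: "a > 1" "d < 1" "a * d = 1" "d > 0" using l by (auto simp: a_def d_def simp flip: exp_add)
  have ke: "k$1$1 = x * x * a + y * y * d" "k$1$2 = x * y * (d - a)"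
    "k$2$1 = x * y * (d - a)" "k$2$2 = y * y * a + x * x * d"
    unfolding k by (simp_all add: matrix_mult_2 geo_mat_def inv2_def rot algebra_simps flip: x_def y_def a_def d_def)
  have dk: "det k = 1" using d\<rho> inv2(1)[OF d\<rho>] by (simp add: k det_mul det_geo_mat)
  have comb: "\<bar>r * a + s * d - 1\<bar> \<le> a - d" if "r + s = 1" "r \<ge> 0" "s \<ge> 0" for r s :: real
  proof -
    define P Q where "P = r * (a - 1)" and "Q = s * (1 - d)"
    have "r * a + s * d - 1 = P - Q" using that(1) by (simp add: P_def Q_def algebra_simps)
    moreover have "P \<le> 1 * (a - 1)" "0 \<le> P" "Q \<le> 1 * (1 - d)" "0 \<le> Q"
      unfolding P_def Q_def using that ad by (intro mult_right_mono mult_nonneg_nonneg; simp)+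
    ultimately show ?thesis using ad by (simp add: abs_le_iff)
  qed
  have "\<bar>x * y\<bar> \<le> 1"
  proof -
    have "(\<bar>x\<bar> - \<bar>y\<bar>)\<^sup>2 \<ge> 0" by simp
    moreover have "(\<bar>x\<bar> - \<bar>y\<bar>)\<^sup>2 = x * x + y * y - 2 * (\<bar>x\<bar> * \<bar>y\<bar>)"
      by (simp add: power2_eq_square algebra_simps)
    ultimately have "2 * (\<bar>x\<bar> * \<bar>y\<bar>) \<le> x * x + y * y" by linarith
    then show ?thesis using xy by (simp add: abs_mult)
  qed
  then have off: "\<bar>x * y * (d - a)\<bar> \<le> a - d"
    using ad mult_right_mono[of "\<bar>x * y\<bar>" 1 "a - d"] by (simp add: abs_mult)
  have "entry_norm (k - mat 1) \<le> 4 * (a - d)"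
    using comb[of "x * x" "y * y"] comb[of "y * y" "x * x"] xy off
    by (simp add: entry_norm_def ke mat_def add.commute)
  moreover have "?h *v e1 \<noteq> e1"
  proof
    assume "?h *v e1 = e1"
    then have "(?h *v e1)$1 = 1" "(?h *v e1)$2 = 0" by (simp_all add: e1_nth)
    then have "?h$1$1 = 1" "?h$2$1 = 0" by (simp_all add: matrix_vector_2 e1_nth)
    then have "k$1$1 = 1" "k$2$1 = 0" by (simp_all add: k_def geo_conj_def)
    then have "k$2$2 = 1" using dk by (simp add: det_2)
    then have "(x * x + y * y) * (a + d) = 2" using \<open>k$1$1 = 1\<close> by (simp add: ke algebra_simps)
    then have "a + d = 2" using xy by simp
    then have d: "d = 2 - a" by simp
    have "(a - 1) * (a - 1) = 1 - a * d" unfolding d by (simp add: algebra_simps)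
    then have "(a - 1) * (a - 1) = 0" using ad(3) by simp
    then show False using ad by simp
  qed
  ultimately show ?thesis using t E unfolding k_def a_def d_def by blast
qed


text \<open>The crossing times tend to infinity: up to a fixed time, a translation that is short in the frame at the
  crossing point is close to 1 in the frame \<open>g\<close> as well, and discreteness leaves only the identity.\<close>

lemma arbitrarily_short_crossings:
  assumes disc: "discrete_subgroup \<Gamma>" and g: "det g = 1"
    and C: "\<And>n::nat. closed_geodesic \<Gamma> (C n) (l n)"
    and meets: "\<And>n. geodesic_ray (vec_orbit \<Gamma> g) \<inter> C n \<noteq> {}"
    and l: "l \<longlonglongrightarrow> 0" and \<eta>: "\<eta> > 0"
  shows "\<exists>h\<in>(\<lambda>B. inv2 g ** B ** g) ` matrices \<Gamma>. \<exists>t\<ge>1/\<eta>.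
     dist (geo_conj t h) (mat 1) < \<eta> \<and> h *v e1 \<noteq> e1"
proof -
  obtain e where e: "e > 0" "\<And>B. B \<in> matrices \<Gamma> \<Longrightarrow> dist B (mat 1) < e \<Longrightarrow> B = mat 1 \<or> B = - mat 1"
    using discrete_isolated[OF disc lift.one] by blast
  define N where "N = entry_norm g * entry_norm (inv2 g)"
  have N: "N \<ge> 0" by (simp add: N_def entry_norm_nonneg)
  define r where "r = min \<eta> (min 1 e / (exp (1/\<eta>) * (N + 1)))"
  have r: "r > 0" using e(1) \<eta> N by (simp add: r_def)
  have "(\<lambda>n. 4 * (exp (l n / 2) - exp (- (l n / 2)))) \<longlonglongrightarrow> 4 * (exp (0 / 2) - exp (- (0 / 2)))"
    by (intro tendsto_intros l) auto
  then have "(\<lambda>n. 4 * (exp (l n / 2) - exp (- (l n / 2)))) \<longlonglongrightarrow> 0" by simp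
  from order_tendstoD(2)[OF this r] obtain n where n: "4 * (exp (l n / 2) - exp (- (l n / 2))) < r"
    unfolding eventually_sequentially by blast
  obtain t B where t: "t \<ge> 0" and B: "B \<in> matrices \<Gamma>"
    and small: "entry_norm (geo_conj t (inv2 g ** B ** g) - mat 1) < r"
    and moves: "(inv2 g ** B ** g) *v e1 \<noteq> e1"
    using short_geodesic_crossing[OF g C meets, of n] n by force
  let ?h = "inv2 g ** B ** g"
  have "t \<ge> 1/\<eta>"
  proof (rule ccontr)
    assume "\<not> t \<ge> 1/\<eta>"
    then have tT: "exp t \<le> exp (1/\<eta>)" by simp
    define D where "D = geo_conj t ?h - mat 1"
    have "?h - mat 1 = geo_conj (- t) D"
      by (rule matrix2_eqI) (simp_all add: D_def geo_conj_def mat_def exp_minus)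
    moreover have "entry_norm (geo_conj (- t) D) \<le> exp t * entry_norm D"
    proof -
      have "1 \<le> exp t" "exp (- t) \<le> exp t" using t by simp_all
      then have "c \<le> exp t * c" "exp (- t) * c \<le> exp t * c" if "c \<ge> 0" for c
        using that mult_right_mono[of 1 "exp t" c] mult_right_mono[of "exp (- t)" "exp t" c] by simp_all
      from this(1)[of "\<bar>D$1$1\<bar>"] this(1)[of "\<bar>D$2$2\<bar>"] this(2)[of "\<bar>D$2$1\<bar>"]
      show ?thesis by (simp add: entry_norm_def geo_conj_def abs_mult distrib_left)
    qed
    ultimately have hs: "entry_norm (?h - mat 1) \<le> exp (1/\<eta>) * r"
      using mult_mono[OF tT less_imp_le[OF small[folded D_def]]] entry_norm_nonneg[of D] by simp
    have "B - mat 1 = g ** (?h - mat 1) ** inv2 g"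
    proof -
      have dist: "X ** (P - Q) = X ** P - X ** Q" "(P - Q) ** X = P ** X - Q ** X" for X P Q :: "real^2^2"
        by (rule matrix2_eqI; simp add: matrix_mult_2 algebra_simps)+
      have "g ** (?h - mat 1) ** inv2 g = (g ** inv2 g) ** B ** (g ** inv2 g) - g ** inv2 g"
        by (simp add: matrix_mul_assoc dist)
      then show ?thesis using inv2(3)[OF g] by simp
    qed
    then have "entry_norm (B - mat 1) \<le> entry_norm g * entry_norm (?h - mat 1) * entry_norm (inv2 g)"
      using order_trans[OF entry_norm_mult mult_right_mono[OF entry_norm_mult entry_norm_nonneg]] by simp
    also have "\<dots> \<le> entry_norm g * (exp (1/\<eta>) * r) * entry_norm (inv2 g)"
      using hs by (intro mult_right_mono mult_left_mono entry_norm_nonneg)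
    also have "\<dots> = N * (exp (1/\<eta>) * r)" by (simp add: N_def)
    also have "\<dots> < (N + 1) * (exp (1/\<eta>) * r)" using r by (intro mult_strict_right_mono) auto
    also have "\<dots> = r * (exp (1/\<eta>) * (N + 1))" by simp
    also have "\<dots> \<le> min 1 e / (exp (1/\<eta>) * (N + 1)) * (exp (1/\<eta>) * (N + 1))"
      using N by (intro mult_right_mono) (simp_all add: r_def)
    also have "\<dots> = min 1 e" using N by (simp add: add_eq_0_iff)
    finally have d: "dist B (mat 1) < min 1 e" using dist_le_entries[of B "mat 1"] by linarith
    have "B \<noteq> - mat 1"
      using entry_le_dist[of B 1 1 "mat 1"] d by (auto simp: mat_def)
    then have "B = mat 1" using e(2)[OF B] d by auto
    then have "?h = mat 1" using inv2(2)[OF g] by simp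
    then show False using moves by simp
  qed
  moreover have "dist (geo_conj t ?h) (mat 1) < \<eta>"
    using dist_le_entries[of "geo_conj t ?h" "mat 1"] small by (simp add: r_def)
  ultimately show ?thesis using B moves by blast
qed

end

section \<open>Uncountably many horocyclic orbits\<close>

lemma uncountable_nat_to_bool: "uncountable (UNIV :: (nat \<Rightarrow> bool) set)"
proof
  assume "countable (UNIV :: (nat \<Rightarrow> bool) set)"
  then obtain f :: "nat \<Rightarrow> nat \<Rightarrow> bool" where "surj f"
    using uncountable_def[of "UNIV :: (nat \<Rightarrow> bool) set"] by blast
  then obtain n where "f n = (\<lambda>k. \<not> f k k)" by (metis surjD)
  then show False by metis
qed

theorem mainTheorem1:
  fixes \<Gamma> :: "(real^2^2) set set"
    and u :: "(complex \<times> complex) set"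
  assumes "discrete_subgroup \<Gamma>" and "torsion_free \<Gamma>"
    and "u \<in> T1S \<Gamma>"
    and "\<exists>C l. (\<forall>n::nat. closed_geodesic \<Gamma> (C n) (l n) \<and> geodesic_ray u \<inter> C n \<noteq> {}) \<and>
               l \<longlonglongrightarrow> 0"
  shows "horocyclic_orbit u \<subset> strong_stable_set \<Gamma> u \<and>
         (\<exists>\<O>. \<O> \<subseteq> horocyclic_orbit ` T1S \<Gamma> \<and> uncountable \<O> \<and>
              strong_stable_set \<Gamma> u = \<Union>\<O>)"
proof -
  have sub: "subgroup \<Gamma> PSL2R" using assms(1) by (simp add: discrete_subgroup_def)
  interpret lift: sl2_group "matrices \<Gamma>" by (rule matrices_sl2_group[OF sub])
  obtain g where g: "det g = 1" "u = vec_orbit \<Gamma> g" using assms(3) unfolding T1S_vec_orbit[OF sub] by blast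
  obtain C l where Cl: "\<And>n::nat. closed_geodesic \<Gamma> (C n) (l n)" "\<And>n. geodesic_ray u \<inter> C n \<noteq> {}" "l \<longlonglongrightarrow> 0"
    using assms(4) by blast
  define H where "H = (\<lambda>B. inv2 g ** B ** g) ` matrices \<Gamma>"
  interpret H: sl2_group H unfolding H_def by (rule conjugate_group[OF sub g(1)])
  have "\<exists>h\<in>H. \<exists>t\<ge>1/\<eta>. dist (geo_conj t h) (mat 1) < \<eta> \<and> h *v e1 \<noteq> e1" if "\<eta> > 0" for \<eta>
    unfolding H_def
    by (rule arbitrarily_short_crossings[OF sub assms(1) g(1) Cl(1) Cl(2)[unfolded g(2)] Cl(3) that])
  from H.sparse_crossings_exist[OF this] obtain B \<delta> t h where "sparse_crossings H B \<delta> t h" by blast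
  then interpret sparse_crossings H B \<delta> t h .
  let ?W = "strong_stable_set \<Gamma> u"
  define v where "v = (\<lambda>\<epsilon>. vec_orbit \<Gamma> (g ** limit_mat \<epsilon>))"
  have det_gf: "det (g ** limit_mat \<epsilon>) = 1" for \<epsilon> using g limit_mat(1) by (simp add: det_mul)
  have vW: "v \<epsilon> \<in> ?W" for \<epsilon>
    unfolding v_def g(2)
    by (rule strong_stable_member[OF sub g(1) limit_mat(1)]) (use limit_mat_asymptotic in \<open>simp add: H_def\<close>)
  have uW: "u \<in> ?W"
  proof -
    have "vec_orbit \<Gamma> (g ** mat 1) \<in> strong_stable_set \<Gamma> (vec_orbit \<Gamma> g)"
    proof (rule strong_stable_member[OF sub g(1)])
      fix \<eta> :: real assume "\<eta> > 0"
      moreover have "geo_conj t (inv2 (inv2 g ** mat 1 ** g) ** mat 1) = mat 1" for t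
      proof -
        have "geo_conj t (mat 1) = mat 1" by (rule matrix2_eqI) (simp_all add: geo_conj_def mat_def)
        then show ?thesis using inv2(2)[OF g(1)] by (simp add: inv2_one)
      qed
      ultimately show "\<forall>\<^sub>F t in at_top. \<exists>B\<in>matrices \<Gamma>. dist (geo_conj t (inv2 (inv2 g ** B ** g) ** mat 1)) (mat 1) < \<eta>"
        using lift.one by (intro always_eventually allI bexI[of _ "mat 1"]) auto
    qed (simp add: det_2 mat_def)
    then show ?thesis by (simp add: g(2))
  qed
  have WT: "?W \<subseteq> T1S \<Gamma>" by (auto simp: strong_stable_set_def)
  have orbit_W: "horocyclic_orbit x \<subseteq> ?W" if "x \<in> ?W" for x
    using strong_stable_horo[OF sub assms(3) that] unfolding horocyclic_orbit_def by blast
  define \<O> where "\<O> = horocyclic_orbit ` ?W"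
  have W_eq: "?W = \<Union>\<O>"
    using orbit_W horocyclic_orbit_self[OF sub] WT unfolding \<O>_def by blast
  have unc: "uncountable \<O>"
  proof
    assume "countable \<O>"
    then have c: "countable (range (\<lambda>\<epsilon>. horocyclic_orbit (v \<epsilon>)))"
      by (rule countable_subset[rotated]) (use vW in \<open>auto simp: \<O>_def\<close>)
    \<comment> \<open>The first column determines the choice, and equal orbits have first columns that differ by an
        element of a countable group.\<close>
    have fibre: "countable {\<epsilon>. horocyclic_orbit (v \<epsilon>) = horocyclic_orbit (v \<epsilon>')}" for \<epsilon>'
    proof -
      let ?Y = "(\<lambda>D. inv2 g *v (D *v (g *v first_col \<epsilon>' 0))) ` matrices \<Gamma>"
      have "(\<lambda>\<epsilon>. first_col \<epsilon> 0) ` {\<epsilon>. horocyclic_orbit (v \<epsilon>) = horocyclic_orbit (v \<epsilon>')} \<subseteq> ?Y"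
      proof (rule image_subsetI)
        fix \<epsilon> assume "\<epsilon> \<in> {\<epsilon>. horocyclic_orbit (v \<epsilon>) = horocyclic_orbit (v \<epsilon>')}"
        then have "v \<epsilon> \<in> horocyclic_orbit (v \<epsilon>')"
          using horocyclic_orbit_self[OF sub, of "v \<epsilon>"] vW WT by blast
        then obtain s where "v \<epsilon> = vec_orbit \<Gamma> (g ** limit_mat \<epsilon>' ** horo_mat s)"
          unfolding v_def horocyclic_orbit_vec_orbit[OF sub det_gf] by blast
        then have "SL2R_act (g ** limit_mat \<epsilon>) base_vec \<in> vec_orbit \<Gamma> (g ** limit_mat \<epsilon>' ** horo_mat s)"
          using vec_orbit_self[OF sub] unfolding v_def by metis
        then obtain D where D: "D \<in> matrices \<Gamma>" "g ** limit_mat \<epsilon> = D ** (g ** limit_mat \<epsilon>' ** horo_mat s)"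
          by (rule in_vec_orbit[OF sub _ det_gf, rotated]) (simp_all add: det_mul g(1) limit_mat(1) det_horo_mat)
        have "horo_mat s *v e1 = e1"
          by (simp add: vec_eq_iff forall_2 matrix_vector_2 e1_nth horo_mat_def)
        then have "g *v first_col \<epsilon> 0 = D *v (g *v first_col \<epsilon>' 0)"
          using arg_cong[OF D(2), of "\<lambda>M. M *v e1"] by (simp add: limit_mat(2) flip: matrix_vector_mul_assoc)
        then have "(inv2 g ** g) *v first_col \<epsilon> 0 = inv2 g *v (D *v (g *v first_col \<epsilon>' 0))"
          by (simp flip: matrix_vector_mul_assoc)
        then show "first_col \<epsilon> 0 \<in> ?Y" using inv2(2)[OF g(1)] D(1) by auto
      qed
      then have "countable ((\<lambda>\<epsilon>. first_col \<epsilon> 0) ` {\<epsilon>. horocyclic_orbit (v \<epsilon>) = horocyclic_orbit (v \<epsilon>')})"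
        by (rule countable_subset) (simp add: discrete_countable[OF assms(1)])
      then show ?thesis by (rule countable_image_inj_on) (rule inj_on_subset[OF first_col_inj subset_UNIV])
    qed
    have "countable (\<Union>X\<in>range (\<lambda>\<epsilon>. horocyclic_orbit (v \<epsilon>)). {\<epsilon>. horocyclic_orbit (v \<epsilon>) = X})"
      by (rule countable_UN[OF c]) (use fibre in auto)
    moreover have "(\<Union>X\<in>range (\<lambda>\<epsilon>. horocyclic_orbit (v \<epsilon>)). {\<epsilon>. horocyclic_orbit (v \<epsilon>) = X}) = UNIV" by blast
    ultimately show False using uncountable_nat_to_bool by metis
  qed
  have "horocyclic_orbit u \<noteq> ?W"
  proof
    assume eq: "horocyclic_orbit u = ?W"
    have "\<O> \<subseteq> {horocyclic_orbit u}"
      unfolding \<O>_def using horocyclic_orbit_eq[OF sub assms(3)] eq by blast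
    then have "countable \<O>" by (rule countable_subset) simp
    then show False using unc by blast
  qed
  then have "horocyclic_orbit u \<subset> ?W" using orbit_W[OF uW] by blast
  moreover have "\<O> \<subseteq> horocyclic_orbit ` T1S \<Gamma>" using WT unfolding \<O>_def by blast
  ultimately show ?thesis using unc W_eq by blast
qed

end
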